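(* Let $(\Lambda V,d)$ be a 1-connected elliptic minimal Sullivan model over $\mathbb{Q}$ whose differential is homogeneous of length $2$ (i.e. the model is coformal: $d(V)\subset \Lambda^2 V$), and suppose that $V$ has generators of odd degree only, i.e. $V^{\text{even}}=0$. Then $\dim_{\mathbb{Q}} H^*(\Lambda V,d)\geq \dim_{\mathbb{Q}} V$.
   Context: For a graded $\mathbb{Q}$-vector space $V$, $\Lambda V$ is the free graded-commutative algebra on $V$, $\Lambda^k V$ is the span of the elements of wordlength $k$, and $\Lambda^{\geq n}V=\bigoplus_{k\geq n}\Lambda^kV$. A minimal Sullivan model is a commutative differential graded algebra $(\Lambda V,d)$ over $\mathbb{Q}$, satisfying the usual Sullivan nilpotence condition, with $dV\subset \Lambda^{\geq 2}V$. It is 1-connected if $V$ is concentrated in degrees $\geq 2$, and elliptic if both $V$ and $H^*(\Lambda V,d)$ are finite dimensional. $V^{\text{even}}$ denotes the part of $V$ in even degrees. Dimensions are total dimensions over all degrees. *)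

theory Defs
  imports Complex_Main "HOL-Library.Poly_Mapping"
begin

text \<open>
  Lists are the free monoid, so \<open>'g list \<Rightarrow>\<^sub>0 rat\<close> with its convolution product is the free
  associative unital \<open>\<rat>\<close>-algebra on the set of generators \<open>'g\<close>.
\<close>

instantiation list :: (type) monoid_add
begin

definition zero_list_def: "(0 :: 'a list) = []"
definition plus_list_def: "(xs :: 'a list) + ys = xs @ ys"

instance
  by standard (simp_all add: zero_list_def plus_list_def)

end

abbreviation word :: "'g \<Rightarrow> 'g list \<Rightarrow>\<^sub>0 rat"
  where "word v \<equiv> Poly_Mapping.single [v] 1"

abbreviation const :: "rat \<Rightarrow> 'g list \<Rightarrow>\<^sub>0 rat"
  where "const c \<equiv> Poly_Mapping.single 0 c"


section \<open>Subquotients of a vector space\<close>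

locale rat_vector_space = vector_space scale
  for scale :: "rat \<Rightarrow> 'b::ab_group_add \<Rightarrow> 'b"
begin

definition finite_dim :: "'b set \<Rightarrow> bool"
  where "finite_dim S \<longleftrightarrow> (\<exists>B. finite B \<and> S \<subseteq> span B)"

text \<open>
  For subspaces \<open>T \<subseteq> S\<close>, the quotient \<open>S / T\<close> is handled through representatives:
  \<open>basis_mod S T X\<close> says that \<open>X \<subseteq> S\<close> is mapped bijectively onto a basis of \<open>S / T\<close>.
\<close>

definition spans_mod :: "'b set \<Rightarrow> 'b set \<Rightarrow> 'b set \<Rightarrow> bool"
  where "spans_mod S T X \<longleftrightarrow> X \<subseteq> S \<and> (\<forall>s\<in>S. \<exists>x\<in>span X. s - x \<in> T)"

definition independent_mod :: "'b set \<Rightarrow> 'b set \<Rightarrow> bool"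
  where "independent_mod T X \<longleftrightarrow>
    (\<forall>F \<subseteq> X. finite F \<longrightarrow> (\<forall>u. (\<Sum>v\<in>F. scale (u v) v) \<in> T \<longrightarrow> (\<forall>v\<in>F. u v = 0)))"

definition basis_mod :: "'b set \<Rightarrow> 'b set \<Rightarrow> 'b set \<Rightarrow> bool"
  where "basis_mod S T X \<longleftrightarrow> spans_mod S T X \<and> independent_mod T X"

definition finite_dim_mod :: "'b set \<Rightarrow> 'b set \<Rightarrow> bool"
  where "finite_dim_mod S T \<longleftrightarrow> (\<exists>X. finite X \<and> spans_mod S T X)"

definition dim_mod :: "'b set \<Rightarrow> 'b set \<Rightarrow> nat"
  where "dim_mod S T = (if \<exists>X. basis_mod S T X then card (SOME X. basis_mod S T X) else 0)"

end

text \<open>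
  These notions agree with the dimension of any vector space that realises the quotient.
\<close>

locale rat_linear = vs1: rat_vector_space s1 + vs2: rat_vector_space s2 + Vector_Spaces.linear s1 s2 f
  for s1 :: "rat \<Rightarrow> 'b::ab_group_add \<Rightarrow> 'b" (infixr \<open>*a\<close> 75)
    and s2 :: "rat \<Rightarrow> 'c::ab_group_add \<Rightarrow> 'c" (infixr \<open>*b\<close> 75)
    and f :: "'b \<Rightarrow> 'c"

lemma (in rat_linear) basis_mod_image:
  assumes S: "vs1.subspace S" and surj: "f ` S = UNIV"
    and ker: "\<And>x. x \<in> S \<Longrightarrow> f x = 0 \<longleftrightarrow> x \<in> T" and TS: "T \<subseteq> S"
  shows "vs1.basis_mod S T X \<longleftrightarrow>
    X \<subseteq> S \<and> inj_on f X \<and> vs2.independent (f ` X) \<and> vs2.span (f ` X) = UNIV"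
proof (cases "X \<subseteq> S")
  case XS: True
  have spS: "vs1.span X \<subseteq> S"
    using XS S by (rule vs1.span_minimal)
  have "vs1.spans_mod S T X \<longleftrightarrow> (\<forall>s\<in>S. \<exists>x\<in>vs1.span X. f s = f x)"
  proof -
    have "s - x \<in> T \<longleftrightarrow> f s = f x" if "s \<in> S" "x \<in> vs1.span X" for s x
    proof -
      have "s - x \<in> S" using that spS S by (intro vs1.subspace_diff) auto
      from ker[OF this] show ?thesis by (simp add: diff)
    qed
    then show ?thesis
      unfolding vs1.spans_mod_def using XS by (simp cong: bex_cong)
  qed
  also have "\<dots> \<longleftrightarrow> UNIV \<subseteq> f ` vs1.span X"
  proof
    assume l: "\<forall>s\<in>S. \<exists>x\<in>vs1.span X. f s = f x"
    show "UNIV \<subseteq> f ` vs1.span X"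
    proof
      fix y
      have "y \<in> f ` S" using surj by simp
      then show "y \<in> f ` vs1.span X" using l by force
    qed
  qed blast
  also have "\<dots> \<longleftrightarrow> vs2.span (f ` X) = UNIV"
    by (auto simp: span_image)
  finally have 1: "vs1.spans_mod S T X \<longleftrightarrow> vs2.span (f ` X) = UNIV" .
  have mem: "(\<Sum>v\<in>F. u v *a v) \<in> T \<longleftrightarrow> (\<Sum>v\<in>F. u v *b f v) = 0" if "F \<subseteq> X" for F u
  proof -
    have "(\<Sum>v\<in>F. u v *a v) \<in> S"
      using that XS S by (intro vs1.subspace_sum vs1.subspace_scale) auto
    from ker[OF this] show ?thesis by (simp add: sum scale)
  qed
  have "vs1.independent_mod T X \<longleftrightarrow>
      (\<forall>F \<subseteq> X. finite F \<longrightarrow> (\<forall>u. (\<Sum>v\<in>F. u v *b f v) = 0 \<longrightarrow> (\<forall>v\<in>F. u v = 0)))"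
    unfolding vs1.independent_mod_def using mem by simp
  also have "\<dots> \<longleftrightarrow> inj_on f X \<and> vs2.independent (f ` X)" (is "?l \<longleftrightarrow> ?r")
  proof
    assume l: ?l
    have inj: "inj_on f X"
    proof (rule inj_onI, rule ccontr)
      fix x y assume xy: "x \<in> X" "y \<in> X" "f x = f y" "x \<noteq> y"
      have "(\<Sum>v\<in>{x,y}. (if v = x then 1 else - 1) *b f v) = 0"
        using xy by simp
      then have "(if x = x then 1 else - 1 :: rat) = 0"
        using l[rule_format, of "{x,y}" "\<lambda>v. if v = x then 1 else - 1" x] xy by simp
      then show False by simp
    qed
    moreover have "vs2.independent (f ` X)"
      unfolding vs2.independent_explicit_finite_subsets
    proof (intro allI impI ballI)
      fix G u w assume G: "G \<subseteq> f ` X" "finite G" "(\<Sum>v\<in>G. u v *b v) = 0" "w \<in> G"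
      then obtain F where F: "F \<subseteq> X" "finite F" "G = f ` F"
        by (meson finite_subset_image)
      have injF: "inj_on f F" using inj F(1) by (rule inj_on_subset)
      have "(\<Sum>v\<in>F. u (f v) *b f v) = 0"
        using G(3) unfolding F(3) by (simp add: sum.reindex[OF injF])
      then have "\<forall>v\<in>F. u (f v) = 0"
        using l[rule_format, of F "\<lambda>v. u (f v)"] F by blast
      then show "u w = 0" using G(4) F(3) by auto
    qed
    ultimately show ?r ..
  next
    assume r: ?r
    show ?l
    proof (intro allI impI ballI)
      fix F u v assume F: "F \<subseteq> X" "finite F" "(\<Sum>v\<in>F. u v *b f v) = 0" "v \<in> F"
      have injF: "inj_on f F" using r F(1) inj_on_subset by blast
      have "(\<Sum>w\<in>f ` F. u (the_inv_into F f w) *b w) = 0"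
        using F(3) by (simp add: sum.reindex[OF injF] the_inv_into_f_f[OF injF] cong: sum.cong)
      moreover have "f ` F \<subseteq> f ` X" using F(1) by (rule image_mono)
      ultimately have "u (the_inv_into F f (f v)) = 0"
        using r[THEN conjunct2, unfolded vs2.independent_explicit_finite_subsets,
          rule_format, of "f ` F" "\<lambda>w. u (the_inv_into F f w)" "f v"] F(2,4) by simp
      then show "u v = 0" using the_inv_into_f_f[OF injF F(4)] by simp
    qed
  qed
  finally show ?thesis
    unfolding vs1.basis_mod_def using 1 XS by blast
qed (auto simp: vs1.basis_mod_def vs1.spans_mod_def)

lemma (in rat_linear) dim_mod_eq_dim:
  assumes S: "vs1.subspace S" and surj: "f ` S = UNIV"
    and ker: "\<And>x. x \<in> S \<Longrightarrow> f x = 0 \<longleftrightarrow> x \<in> T" and TS: "T \<subseteq> S"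
  shows "vs1.dim_mod S T = vs2.dim UNIV"
proof -
  note im = basis_mod_image[OF S surj ker TS]
  obtain B where B: "vs2.independent B" "vs2.span B = UNIV"
    using vs2.basis_exists[of UNIV] by (metis top.extremum_uniqueI)
  have "B \<subseteq> f ` S" using surj by simp
  then obtain X where X: "X \<subseteq> S" "inj_on f X" "B = f ` X"
    by (auto simp: subset_image_inj)
  then have "vs1.basis_mod S T X" using B im by blast
  then have ex: "\<exists>X. vs1.basis_mod S T X" ..
  define Y where "Y = (SOME X. vs1.basis_mod S T X)"
  have "vs1.basis_mod S T Y" unfolding Y_def by (rule someI_ex[OF ex])
  then have Y: "inj_on f Y" "vs2.independent (f ` Y)" "vs2.span (f ` Y) = UNIV"
    using im by blast+
  have "vs1.dim_mod S T = card Y"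
    using ex by (simp add: vs1.dim_mod_def Y_def)
  also have "\<dots> = card (f ` Y)" using Y(1) by (simp add: card_image)
  also have "\<dots> = vs2.dim UNIV"
    using Y(2,3) by (intro vs2.basis_card_eq_dim) auto
  finally show ?thesis .
qed


section \<open>Free graded-commutative algebras\<close>

locale rat_algebra = rat_vector_space scale
  for scale :: "rat \<Rightarrow> 'a::ring_1 \<Rightarrow> 'a" (infixr \<open>*q\<close> 75) +
  assumes scale_mult_left: "(c *q x) * y = c *q (x * y)"
    and scale_mult_right: "x * (c *q y) = c *q (x * y)"
begin

definition eval :: "('g \<Rightarrow> 'a) \<Rightarrow> ('g list \<Rightarrow>\<^sub>0 rat) \<Rightarrow> 'a"
  where "eval f p = (\<Sum>w\<in>Poly_Mapping.keys p. Poly_Mapping.lookup p w *q prod_list (map f w))"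

lemma eval_superset:
  assumes "finite W" "Poly_Mapping.keys p \<subseteq> W"
  shows "eval f p = (\<Sum>w\<in>W. Poly_Mapping.lookup p w *q prod_list (map f w))"
  unfolding eval_def using assms
  by (intro sum.mono_neutral_left) (auto simp: in_keys_iff)

lemma eval_zero [simp]: "eval f 0 = 0"
  by (simp add: eval_def)

lemma eval_single [simp]: "eval f (Poly_Mapping.single w c) = c *q prod_list (map f w)"
  using eval_superset[of "{w}" "Poly_Mapping.single w c" f] by simp

lemma eval_add [simp]: "eval f (p + q) = eval f p + eval f q"
proof -
  let ?W = "Poly_Mapping.keys p \<union> Poly_Mapping.keys q"
  have "Poly_Mapping.keys (p + q) \<subseteq> ?W" by (rule Poly_Mapping.keys_add)
  then show ?thesis
    using eval_superset[of ?W "p + q" f] eval_superset[of ?W p f] eval_superset[of ?W q f]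
    by (simp add: lookup_add scale_left_distrib sum.distrib)
qed

lemma eval_uminus [simp]: "eval f (- p) = - eval f p"
  using eval_add[of f "- p" p] by (simp add: eq_neg_iff_add_eq_0)

lemma eval_diff [simp]: "eval f (p - q) = eval f p - eval f q"
  using eval_add[of f p "- q"] by simp

lemma free_algebra_induct [case_names single add]:
  fixes p :: "'g list \<Rightarrow>\<^sub>0 rat"
  assumes "\<And>w c. P (Poly_Mapping.single w c)"
    and "\<And>p q. P p \<Longrightarrow> P q \<Longrightarrow> P (p + q)"
  shows "P p"
proof -
  have P0: "P 0" using assms(1)[of 0 0] by simp
  have "P (\<Sum>w\<in>W. Poly_Mapping.single w (Poly_Mapping.lookup p w))" if "finite W" for W
    using that by induction (simp_all add: P0 assms)
  moreover have "(\<Sum>w\<in>Poly_Mapping.keys p. Poly_Mapping.single w (Poly_Mapping.lookup p w)) = p"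
    by (rule poly_mapping_eqI)
      (simp add: lookup_sum lookup_single when_def in_keys_iff)
  ultimately show ?thesis by (metis finite_keys)
qed

lemma eval_mult [simp]: "eval f (p * q) = eval f p * eval f q"
proof (induction p rule: free_algebra_induct)
  case (single w c)
  show ?case
    by (induction q rule: free_algebra_induct)
      (simp_all add: mult_single plus_list_def scale_mult_left scale_mult_right distrib_left)
qed (simp add: distrib_right)

lemma eval_one [simp]: "eval f 1 = 1"
  unfolding single_one[symmetric] by (simp add: zero_list_def del: single_one)

lemma eval_sign [simp]: "eval f ((- 1) ^ n) = (- 1) ^ n"
  by (induction n) simp_all

end

text \<open>
  A graded subspace \<open>\<Oplus>n. V n\<close> of a \<open>\<rat>\<close>-algebra, and the ideal of the free associative algebra
  \<open>words\<close> on its elements by which one divides to obtain the free graded-commutative algebra: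
  the first two families of relators make the generators depend linearly on the elements of the
  graded space (so together they give the tensor algebra), the third one is graded commutativity.
\<close>

locale graded_subspace = rat_algebra scale
  for scale :: "rat \<Rightarrow> 'a::ring_1 \<Rightarrow> 'a" (infixr \<open>*q\<close> 75) +
  fixes V :: "nat \<Rightarrow> 'a set"
  assumes subspace_V: "subspace (V n)"
    and direct_V: "\<lbrakk>finite N; \<And>n. n \<in> N \<Longrightarrow> x n \<in> V n; (\<Sum>n\<in>N. x n) = 0; n \<in> N\<rbrakk> \<Longrightarrow> x n = 0"
begin

definition total :: "'a set"
  where "total = span (\<Union>n. V n)"

definition words :: "('a list \<Rightarrow>\<^sub>0 rat) set"
  where "words = {p. Poly_Mapping.keys p \<subseteq> lists total}"

definition relators :: "('a list \<Rightarrow>\<^sub>0 rat) set"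
  where "relators =
    {word (v + w) - word v - word w | v w. v \<in> total \<and> w \<in> total} \<union>
    {word (c *q v) - const c * word v | c v. v \<in> total} \<union>
    {word v * word w - (- 1) ^ (m * n) * (word w * word v) | v w m n. v \<in> V m \<and> w \<in> V n}"

inductive_set relation_ideal :: "('a list \<Rightarrow>\<^sub>0 rat) set"
  where
    zero: "0 \<in> relation_ideal"
  | add: "p \<in> relation_ideal \<Longrightarrow> q \<in> relation_ideal \<Longrightarrow> p + q \<in> relation_ideal"
  | mult: "r \<in> relators \<Longrightarrow> p \<in> words \<Longrightarrow> q \<in> words \<Longrightarrow> p * r * q \<in> relation_ideal"

end

text \<open>
  The ambient algebra is \<open>\<Lambda>V\<close>, with \<open>V \<subseteq> \<Lambda>V\<close>: the canonical map from the free associative algebra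
  is onto and its kernel is the ideal of relations.
\<close>

locale free_graded_commutative_algebra = graded_subspace +
  assumes eval_surj: "eval (\<lambda>v. v) ` words = UNIV"
    and eval_kernel: "p \<in> words \<Longrightarrow> eval (\<lambda>v. v) p = 0 \<longleftrightarrow> p \<in> relation_ideal"
begin

text \<open>
  The universal property: a linear map from \<open>V\<close> into an algebra with graded-commuting values
  extends uniquely to a homomorphism of algebras.
\<close>

lemma universal_property:
  fixes s :: "rat \<Rightarrow> 'b::ring_1 \<Rightarrow> 'b" and f :: "'a \<Rightarrow> 'b"
  assumes alg: "rat_algebra s"
    and f_add: "\<And>v w. v \<in> total \<Longrightarrow> w \<in> total \<Longrightarrow> f (v + w) = f v + f w"
    and f_scale: "\<And>c v. v \<in> total \<Longrightarrow> f (c *q v) = s c (f v)"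
    and f_comm: "\<And>v w m n. v \<in> V m \<Longrightarrow> w \<in> V n \<Longrightarrow> f v * f w = (- 1) ^ (m * n) * (f w * f v)"
  shows "\<exists>!h. Vector_Spaces.linear scale s h \<and> h 1 = 1 \<and> (\<forall>x y. h (x * y) = h x * h y) \<and>
    (\<forall>v\<in>total. h v = f v)"
proof -
  interpret B: rat_algebra s by (rule alg)
  have relator: "B.eval f r = 0" if "r \<in> relators" for r
  proof -
    from that consider (sum) v w where "r = word (v + w) - word v - word w" "v \<in> total" "w \<in> total"
      | (scaled) c v where "r = word (c *q v) - const c * word v" "v \<in> total"
      | (comm) v w m n where "r = word v * word w - (- 1) ^ (m * n) * (word w * word v)"
          "v \<in> V m" "w \<in> V n"
      unfolding relators_def by blast
    then show ?thesis
    proof cases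
      case sum
      then show ?thesis by (simp add: f_add)
    next
      case scaled
      then show ?thesis by (simp add: f_scale zero_list_def B.scale_mult_left)
    next
      case comm
      from comm(1) have "B.eval f r = f v * f w - (- 1) ^ (m * n) * (f w * f v)" by simp
      also have "\<dots> = 0" unfolding right_minus_eq by (rule f_comm[OF comm(2,3)])
      finally show ?thesis .
    qed
  qed
  have ideal: "B.eval f p = 0" if "p \<in> relation_ideal" for p
    using that by induction (simp_all add: relator)
  have words_add: "p + q \<in> words" if "p \<in> words" "q \<in> words" for p q
    using that Poly_Mapping.keys_add[of p q] unfolding words_def by blast
  have words_diff: "p - q \<in> words" if "p \<in> words" "q \<in> words" for p q
    using that keys_diff[of p q] unfolding words_def by blast
  have words_mult: "p * q \<in> words" if "p \<in> words" "q \<in> words" for p q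
    using that keys_mult[of p q] unfolding words_def by (fastforce simp: plus_list_def)
  have words_single: "Poly_Mapping.single w c \<in> words" if "w \<in> lists total" for w c
    using that by (auto simp: words_def)
  have words_scale: "const c * p \<in> words" if "p \<in> words" for c p
    using that words_single[of 0 c] by (auto intro!: words_mult simp: zero_list_def)
  have eq: "B.eval f p = B.eval f q"
    if "p \<in> words" "q \<in> words" "eval (\<lambda>v. v) p = eval (\<lambda>v. v) q" for p q
  proof -
    have "p - q \<in> relation_ideal"
      using that eval_kernel[of "p - q"] words_diff[of p q] by simp
    then show ?thesis using ideal[of "p - q"] by simp
  qed
  have "\<forall>x. \<exists>p. p \<in> words \<and> eval (\<lambda>v. v) p = x"
    using eval_surj by (metis UNIV_I imageE)
  then obtain lift where lift: "\<And>x. lift x \<in> words" "\<And>x. eval (\<lambda>v. v) (lift x) = x"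
    by metis
  define h where "h x = B.eval f (lift x)" for x
  have h_eval: "h (eval (\<lambda>v. v) p) = B.eval f p" if "p \<in> words" for p
    unfolding h_def by (rule eq) (use that lift in auto)
  have h_add: "h (x + y) = h x + h y" for x y
    using h_eval[OF words_add[OF lift(1)[of x] lift(1)[of y]]] by (simp add: lift) (simp add: h_def)
  have h_mult: "h (x * y) = h x * h y" for x y
    using h_eval[OF words_mult[OF lift(1)[of x] lift(1)[of y]]] by (simp add: lift) (simp add: h_def)
  have h_scale: "h (c *q x) = s c (h x)" for c x
    using h_eval[OF words_scale[OF lift(1)[of x]], of c]
    by (simp add: lift zero_list_def scale_mult_left B.scale_mult_left) (simp add: h_def)
  have h_one: "h 1 = 1"
    using h_eval[OF words_single[of "[]" 1]] by simp
  have h_gen: "h v = f v" if "v \<in> total" for v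
    using h_eval[OF words_single[of "[v]" 1]] that by simp
  have h_linear: "Vector_Spaces.linear scale s h"
    by (intro Vector_Spaces.linear.intro module_hom.intro module_hom_axioms.intro
      vector_space_axioms B.vector_space_axioms module_axioms B.module_axioms h_add h_scale)
  show ?thesis
  proof (rule ex1I[of _ h])
    show "Vector_Spaces.linear scale s h \<and> h 1 = 1 \<and> (\<forall>x y. h (x * y) = h x * h y) \<and>
        (\<forall>v\<in>total. h v = f v)"
      using h_linear h_one h_mult h_gen by blast
  next
    fix g assume g: "Vector_Spaces.linear scale s g \<and> g 1 = 1 \<and>
      (\<forall>x y. g (x * y) = g x * g y) \<and> (\<forall>v\<in>total. g v = f v)"
    then interpret g: Vector_Spaces.linear scale s g by blast
    have g_word: "g (prod_list w) = prod_list (map f w)" if "w \<in> lists total" for w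
      using that g by (induction w) auto
    have "g x = h x" for x
    proof -
      have *: "\<And>w. w \<in> Poly_Mapping.keys (lift x) \<Longrightarrow> w \<in> lists total"
        using lift(1)[of x] by (auto simp: words_def)
      have "g x = g (eval (\<lambda>v. v) (lift x))" by (simp add: lift)
      also have "\<dots> = B.eval f (lift x)"
        unfolding eval_def B.eval_def by (simp add: g.sum g.scale g_word * cong: sum.cong)
      finally show ?thesis by (simp add: h_def)
    qed
    then show "g = h" by blast
  qed
qed

definition degree_part :: "nat \<Rightarrow> 'a set"
  where "degree_part n =
    span {prod_list vs | vs ns. list_all2 (\<lambda>v k. v \<in> V k) vs ns \<and> sum_list ns = n}"

definition Lambda :: "nat \<Rightarrow> 'a set"
  where "Lambda k = span {prod_list vs | vs. set vs \<subseteq> total \<and> length vs = k}"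

definition Lambda_ge :: "nat \<Rightarrow> 'a set"
  where "Lambda_ge n = span (\<Union>k\<in>{n..}. Lambda k)"

text \<open>For a graded subspace \<open>S\<close> of \<open>V\<close> this is \<open>\<Lambda>S \<subseteq> \<Lambda>V\<close>.\<close>

definition subalgebra :: "'a set \<Rightarrow> 'a set"
  where "subalgebra S = span {prod_list vs | vs. set vs \<subseteq> S}"

definition is_graded :: "'a set \<Rightarrow> bool"
  where "is_graded S \<longleftrightarrow> S = span (\<Union>n. S \<inter> V n)"

end


section \<open>Sullivan models\<close>

locale sullivan_algebra = free_graded_commutative_algebra +
  fixes d :: "'a \<Rightarrow> 'a"
  assumes linear_d: "Vector_Spaces.linear scale scale d"
    and degree_d: "d ` degree_part n \<subseteq> degree_part (Suc n)"
    and leibniz: "x \<in> degree_part n \<Longrightarrow> d (x * y) = d x * y + (- 1) ^ n * (x * d y)"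
    and d_d: "d (d x) = 0"
    and V_0: "V 0 = {0}"
    and nilpotence: "\<exists>F. (\<forall>k. is_graded (F k)) \<and> (\<forall>k. F k \<subseteq> F (Suc k)) \<and> (\<Union>k. F k) = total \<and>
        d ` F 0 \<subseteq> {0} \<and> (\<forall>k. d ` F (Suc k) \<subseteq> subalgebra (F k))"
begin

definition cocycles :: "'a set"
  where "cocycles = {z. d z = 0}"

definition coboundaries :: "'a set"
  where "coboundaries = range d"

definition dim_cohomology :: nat
  where "dim_cohomology = dim_mod cocycles coboundaries"

definition one_connected :: bool
  where "one_connected \<longleftrightarrow> (\<forall>n<2. V n = {0})"

definition elliptic :: bool
  where "elliptic \<longleftrightarrow> finite_dim total \<and> finite_dim_mod cocycles coboundaries"

definition coformal :: bool
  where "coformal \<longleftrightarrow> d ` total \<subseteq> Lambda 2"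

end

locale minimal_sullivan_algebra = sullivan_algebra +
  assumes minimal: "d ` total \<subseteq> Lambda_ge 2"

end

theory Submission
  imports Defs "HOL-Library.Product_Plus"
begin

text \<open>
  Let \<open>n = dim V\<close>. We show that the cohomology is nonzero in each wordlength \<open>0, \<dots>, n\<close>, which gives
  \<open>n + 1\<close> independent classes. This is Dixmier's argument for nilpotent Lie algebras. Take a
  homogeneous basis of \<open>V\<close>; for a set \<open>S\<close> of basis elements that contains with each element all those
  of lower degree, the common annihilator \<open>A S\<close> of \<open>S\<close> in \<open>\<Lambda>V\<close> is a subcomplex. It is the line
  spanned by the top monomial if \<open>S\<close> is the whole basis, and it is \<open>\<Lambda>V\<close> if \<open>S\<close> is empty.
  Multiplication by a further basis element \<open>x\<close> gives a short exact sequence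
  \<open>0 \<rightarrow> A (S \<union> {x}) \<rightarrow> A S \<rightarrow> A (S \<union> {x}) \<rightarrow> 0\<close>, whose connecting homomorphism preserves the wordlength
  and strictly lowers the degree. Hence it is nilpotent, and cohomology of \<open>A (S \<union> {x})\<close> in
  wordlength \<open>i\<close> forces cohomology of \<open>A S\<close> in the wordlengths \<open>i\<close> and \<open>i - 1\<close>.
\<close>

section \<open>Independent families in a subquotient\<close>

context rat_vector_space
begin

text \<open>The projection that kills a basis of \<open>T\<close> and fixes the other vectors of an
  extended basis. It turns independence modulo \<open>T\<close> into ordinary independence of
  images.\<close>

lemma linear_with_kernel:
  assumes T: "subspace T"
  obtains f where "Vector_Spaces.linear scale scale f" "\<And>x. f x = 0 \<longleftrightarrow> x \<in> T"
proof -
  interpret vector_space_pair scale scale ..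
  obtain C where C: "C \<subseteq> T" "independent C" "T \<subseteq> span C"
    by (rule maximal_independent_subset)
  have spC: "span C = T"
    using C T by (simp add: span_minimal subset_antisym)
  define E where "E = extend_basis C"
  have E: "C \<subseteq> E" "independent E" "span E = UNIV"
    using C by (simp_all add: E_def extend_basis_superset independent_extend_basis)
  define f where "f = construct E (\<lambda>b. if b \<in> C then 0 else b)"
  have lin: "Vector_Spaces.linear scale scale f"
    unfolding f_def by (rule linear_construct) (rule E)
  interpret f: Vector_Spaces.linear scale scale f by (rule lin)
  have fb: "f b = (if b \<in> C then 0 else b)" if "b \<in> E" for b
    using that unfolding f_def by (simp add: construct_basis E)
  have f0: "f t = 0" if "t \<in> span C" for t
    by (rule linear_eq_0_on_span[OF lin _ that]) (use fb E in auto)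
  have f1: "f u = u" if "u \<in> span (E - C)" for u
  proof -
    have "f u = id u"
      by (rule linear_eq_on[OF lin linear_id that]) (use fb in auto)
    then show ?thesis by simp
  qed
  have "f x = 0 \<longleftrightarrow> x \<in> T" for x
  proof
    assume "f x = 0"
    have "x \<in> span (C \<union> (E - C))" using E by (simp add: Un_absorb1)
    then obtain t u where tu: "x = t + u" "t \<in> span C" "u \<in> span (E - C)"
      unfolding span_Un by auto
    then have "u = 0" using \<open>f x = 0\<close> f0 f1 by (simp add: f.add)
    then show "x \<in> T" using tu spC by simp
  qed (use f0 spC in simp)
  with lin that show thesis by blast
qed

text \<open>\<open>dim_mod\<close> picks an arbitrary basis, with default 0 if there is none, and an
  infinite set has \<open>card\<close> 0. So a basis must be shown to exist and the chosen one to be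
  finite; then images under the projection are compared by the exchange bound.\<close>

lemma card_le_dim_mod:
  assumes T: "subspace T" and fin: "finite_dim_mod S T"
    and X: "X \<subseteq> S" "independent_mod T X"
  shows "card X \<le> dim_mod S T"
proof -
  interpret vector_space_pair scale scale ..
  obtain f where lin: "Vector_Spaces.linear scale scale f" and ker: "\<And>x. f x = 0 \<longleftrightarrow> x \<in> T"
    using linear_with_kernel[OF T] by blast
  interpret f: Vector_Spaces.linear scale scale f by (rule lin)
  have ker': "f x = f y \<longleftrightarrow> x - y \<in> T" for x y
    using ker[of "x - y"] by (simp add: f.diff)
  have spans: "f ` S \<subseteq> span (f ` Y)" if Y: "spans_mod S T Y" for Y
  proof
    fix z assume "z \<in> f ` S"
    then obtain s where s: "z = f s" "s \<in> S" by blast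
    then obtain x where "x \<in> span Y" "s - x \<in> T"
      using Y unfolding spans_mod_def by blast
    then show "z \<in> span (f ` Y)" using s ker' f.span_image by auto
  qed
  have indep: "inj_on f Y \<and> independent (f ` Y)" if "independent_mod T Y" for Y
  proof -
    have l: "u v = 0" if "F \<subseteq> Y" "finite F" "(\<Sum>v\<in>F. scale (u v) (f v)) = 0" "v \<in> F" for F u v
    proof -
      have "f (\<Sum>v\<in>F. scale (u v) v) = 0" using that by (simp add: f.sum f.scale)
      then show ?thesis
        using \<open>independent_mod T Y\<close> that unfolding independent_mod_def ker by blast
    qed
    have inj: "inj_on f Y"
    proof (rule inj_onI, rule ccontr)
      fix x y assume xy: "x \<in> Y" "y \<in> Y" "f x = f y" "x \<noteq> y"
      have "(if x = x then 1 else - 1 :: rat) = 0"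
        by (rule l[of "{x,y}" "\<lambda>v. if v = x then 1 else - 1"]) (use xy in auto)
      then show False by simp
    qed
    moreover have "independent (f ` Y)"
      unfolding independent_explicit_finite_subsets
    proof (intro allI impI ballI)
      fix G u w assume G: "G \<subseteq> f ` Y" "finite G" "(\<Sum>v\<in>G. scale (u v) v) = 0" "w \<in> G"
      then obtain F where F: "F \<subseteq> Y" "finite F" "G = f ` F"
        by (meson finite_subset_image)
      have injF: "inj_on f F" using inj F(1) by (rule inj_on_subset)
      obtain v where v: "v \<in> F" "w = f v" using G(4) F(3) by auto
      have "(\<Sum>v\<in>F. scale (u (f v)) (f v)) = 0"
        using G(3) unfolding F(3) by (simp add: sum.reindex[OF injF])
      then show "u w = 0" using l[of F "\<lambda>v. u (f v)" v] F v by simp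
    qed
    ultimately show ?thesis ..
  qed
  obtain Y where Y: "finite Y" "spans_mod S T Y"
    using fin unfolding finite_dim_mod_def by blast
  have bound: "finite Z \<and> card Z \<le> card W"
    if "Z \<subseteq> S" "independent_mod T Z" "spans_mod S T W" "finite W" for Z W
  proof -
    note i = indep[OF that(2)]
    have "f ` Z \<subseteq> span (f ` W)" using spans[OF that(3)] that(1) by blast
    then have "finite (f ` Z) \<and> card (f ` Z) \<le> card (f ` W)"
      using i that(4) by (intro independent_span_bound) auto
    then show ?thesis
      using i card_image_le[OF that(4), of f] finite_image_iff[of f Z] card_image[of f Z] by auto
  qed
  \<comment> \<open>For existence of a basis modulo \<open>T\<close>, thin out the image of the
    spanning set \<open>Y\<close> to a basis \<open>D\<close> and choose one preimage of each
    element.\<close>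
  obtain D where D: "D \<subseteq> f ` Y" "independent D" "f ` Y \<subseteq> span D"
    by (rule maximal_independent_subset)
  then obtain Z where Z: "Z \<subseteq> Y" "inj_on f Z" "D = f ` Z"
    by (auto simp: subset_image_inj)
  have "basis_mod S T Z"
    unfolding basis_mod_def
  proof
    have YS: "Y \<subseteq> S" using Y by (simp add: spans_mod_def)
    have "\<exists>x\<in>span Z. s - x \<in> T" if "s \<in> S" for s
    proof -
      have "span (f ` Y) \<subseteq> span D" using D(3) by (simp add: span_minimal)
      then have "f s \<in> span (f ` Z)" using spans[OF Y(2)] that Z(3) by blast
      then obtain x where "x \<in> span Z" "f s = f x" by (auto simp: f.span_image)
      then show ?thesis using ker' by blast
    qed
    then show "spans_mod S T Z" using Z YS unfolding spans_mod_def by blast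
    show "independent_mod T Z"
      unfolding independent_mod_def
    proof (intro allI impI ballI)
      fix F u v assume F: "F \<subseteq> Z" "finite F" "(\<Sum>v\<in>F. scale (u v) v) \<in> T" "v \<in> F"
      have injF: "inj_on f F" using Z(2) F(1) by (rule inj_on_subset)
      have "(\<Sum>v\<in>F. scale (u v) (f v)) = 0"
        using F(3) unfolding ker[symmetric] by (simp add: f.sum f.scale)
      then have "(\<Sum>w\<in>f ` F. scale (u (the_inv_into F f w)) w) = 0"
        by (simp add: sum.reindex[OF injF] the_inv_into_f_f[OF injF] cong: sum.cong)
      moreover have "f ` F \<subseteq> D" using F(1) Z(3) by blast
      ultimately have "u (the_inv_into F f (f v)) = 0"
        using D(2)[unfolded independent_explicit_finite_subsets,
          rule_format, of "f ` F" "\<lambda>w. u (the_inv_into F f w)" "f v"] F(2,4) by simp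
      then show "u v = 0" using the_inv_into_f_f[OF injF F(4)] by simp
    qed
  qed
  then have ex: "\<exists>X. basis_mod S T X" ..
  define W where "W = (SOME X. basis_mod S T X)"
  have "basis_mod S T W" unfolding W_def by (rule someI_ex[OF ex])
  then have W: "W \<subseteq> S" "spans_mod S T W" "independent_mod T W"
    by (simp_all add: basis_mod_def spans_mod_def)
  have "finite W" using bound[OF W(1,3) Y(2,1)] by blast
  then have "card X \<le> card W" using bound[OF X W(2)] by blast
  also have "card W = dim_mod S T" using ex by (simp add: dim_mod_def W_def)
  finally show ?thesis .
qed

end

section \<open>Two auxiliary algebras\<close>

text \<open>
  Upper triangular matrices of size 2. The off-diagonal entry of a homomorphism into this algebra is
  a derivation twisted by the diagonal entries; contractions will be obtained in this way.
\<close>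

datatype 'a upper = Upper (ul: 'a) (ur: 'a) (lr: 'a)

instantiation upper :: (ring_1) ring_1
begin

definition "0 = Upper 0 0 0"
definition "1 = Upper 1 0 1"
definition "A + B = Upper (ul A + ul B) (ur A + ur B) (lr A + lr B)"
definition "A - B = Upper (ul A - ul B) (ur A - ur B) (lr A - lr B)"
definition "- A = Upper (- ul A) (- ur A) (- lr A)"
definition "A * B = Upper (ul A * ul B) (ul A * ur B + ur A * lr B) (lr A * lr B)"

instance
  by standard
    (simp_all add: zero_upper_def one_upper_def plus_upper_def minus_upper_def uminus_upper_def
      times_upper_def algebra_simps upper.expand)

end

lemma (in rat_algebra) rat_algebra_upper:
  "rat_algebra (\<lambda>c A. Upper (c *q ul A) (c *q ur A) (c *q lr A))"
  by unfold_locales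
    (simp_all add: plus_upper_def times_upper_def scale_left_distrib scale_right_distrib
      scale_mult_left scale_mult_right)

text \<open>With exponents in a group, multiplying by a monomial only shifts coefficients; hence the
  integer indices of the bigrading below.\<close>

lemma lookup_single_times:
  fixes p :: "'m::ab_group_add \<Rightarrow>\<^sub>0 'a::semiring_0"
  shows "Poly_Mapping.lookup (Poly_Mapping.single k a * p) g = a * Poly_Mapping.lookup p (g - k)"
proof -
  have eq: "(g = k + q) = (q = g - k)" for q
    by (metis add.commute add_diff_cancel diff_add_cancel)
  show ?thesis
    by (simp add: lookup_mult lookup_single eq when_mult mult_when Sum_any_right_distrib)
qed

lemma lookup_times_single:
  fixes p :: "'m::ab_group_add \<Rightarrow>\<^sub>0 'a::semiring_0"
  shows "Poly_Mapping.lookup (p * Poly_Mapping.single k a) g = Poly_Mapping.lookup p (g - k) * a"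
proof -
  have eq: "(g = r + k) = (r = g - k)" for r
    by (metis add_diff_cancel diff_add_cancel)
  have "(Poly_Mapping.lookup (Poly_Mapping.single k a) q when g = r + q) =
      ((a when r = g - k) when q = k)" for q r
    using eq[of r] by (cases "q = k") (simp_all add: lookup_single)
  then have "Poly_Mapping.lookup (p * Poly_Mapping.single k a) g =
      (\<Sum>r. Poly_Mapping.lookup p r * (a when r = g - k))"
    by (simp only: lookup_mult Sum_any_when_equal)
  also have "\<dots> = (\<Sum>r. Poly_Mapping.lookup p r * a when r = g - k)"
    by (simp only: mult_when)
  finally show ?thesis by (simp only: Sum_any_when_equal)
qed

text \<open>The coefficient ring need not be commutative, so the constants
  \<open>single 0 (c *q 1)\<close> are first shown to be central; then multiplication by them acts
  as a scalar.\<close>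

lemma (in rat_algebra) rat_algebra_poly_mapping:
  "rat_algebra (\<lambda>c (p :: 'm::ab_group_add \<Rightarrow>\<^sub>0 'a). Poly_Mapping.single 0 (c *q 1) * p)"
proof -
  define k where "k c = (Poly_Mapping.single 0 (c *q 1) :: 'm \<Rightarrow>\<^sub>0 'a)" for c
  have k: "k (a + b) = k a + k b" "k a * k b = k (a * b)" "k 1 = 1" for a b
    by (simp_all add: k_def scale_left_distrib single_add mult_single scale_mult_left)
  have central: "p * k c = k c * p" for c p
    by (rule poly_mapping_eqI)
      (simp add: k_def lookup_times_single lookup_single_times scale_mult_left scale_mult_right)
  have 1: "k a * (k b * p) = k (a * b) * p" for a b p
    by (simp only: k(2)[symmetric] mult.assoc)
  have 2: "p * (k a * q) = k a * (p * q)" for a p q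
    unfolding mult.assoc[symmetric] by (subst central) (rule refl)
  show ?thesis
    unfolding k_def[symmetric]
    by unfold_locales (simp_all only: distrib_left distrib_right k(1,3) 1 mult_1_left, simp only: mult.assoc, rule 2)
qed

section \<open>Models with odd generators\<close>

locale odd_coformal_algebra = minimal_sullivan_algebra scale V d
  for scale :: "rat \<Rightarrow> 'a::ring_1 \<Rightarrow> 'a" (infixr \<open>*q\<close> 75) and V :: "nat \<Rightarrow> 'a set" and d :: "'a \<Rightarrow> 'a" +
  assumes one_connected: "n < 2 \<Longrightarrow> V n = {0}"
    and finite_dim_total: "finite_dim total"
    and coformal: "d ` total \<subseteq> Lambda 2"
    and odd_V: "even n \<Longrightarrow> V n = {0}"
begin

lemma V_subset_total: "v \<in> V n \<Longrightarrow> v \<in> total"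
  unfolding total_def by (rule span_base) blast

text \<open>Since \<open>eval\<close> is onto, products of homogeneous generators span the algebra.
  This induction suits operators governed by their value at 1 and a rule for
  \<open>v * y\<close>.\<close>

lemma Lambda_induct [case_names one mult add scale]:
  assumes one: "P 1"
    and mult: "\<And>v n y. v \<in> V n \<Longrightarrow> P y \<Longrightarrow> P (v * y)"
    and add: "\<And>x y. P x \<Longrightarrow> P y \<Longrightarrow> P (x + y)"
    and scale: "\<And>c x. P x \<Longrightarrow> P (c *q x)"
  shows "P x"
proof -
  have zero: "P 0" using scale[OF one, of 0] by simp
  have total: "P (v * y)" if "v \<in> total" "P y" for v y
  proof -
    have "subspace {v. P (v * y)}"
      by (rule subspaceI) (auto simp: zero distrib_right scale_mult_left intro: add scale)
    then have "v \<in> {v. P (v * y)}"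
      using that mult unfolding total_def by (elim span_induct) auto
    then show ?thesis by simp
  qed
  have word: "P (prod_list w)" if "w \<in> lists total" for w
    using that by (induction w) (simp_all add: one total)
  obtain p where p: "p \<in> words" "x = eval (\<lambda>v. v) p"
    using eval_surj by blast
  have "P (\<Sum>w\<in>W. Poly_Mapping.lookup p w *q prod_list w)"
    if "finite W" "W \<subseteq> lists total" for W
    using that by (induction W) (simp_all add: zero add scale word)
  then show ?thesis
    using p(1) by (simp add: p(2) eval_def words_def)
qed

text \<open>In odd degrees the commutativity relator lies in the ideal, so its evaluation vanishes;
  an even degree forces a zero factor.\<close>

lemma anticommute: "v \<in> V m \<Longrightarrow> w \<in> V n \<Longrightarrow> v * w = - (w * v)"
proof (cases "even m \<or> even n")
  case True
  assume "v \<in> V m" "w \<in> V n"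
  then have "v = 0 \<or> w = 0" using True odd_V by blast
  then show ?thesis by auto
next
  case False
  assume vw: "v \<in> V m" "w \<in> V n"
  let ?r = "word v * word w - (- 1) ^ (m * n) * (word w * word v)"
  have "?r \<in> relators" using vw unfolding relators_def by blast
  moreover have "1 \<in> words" by (simp add: words_def zero_list_def)
  ultimately have ideal: "1 * ?r * 1 \<in> relation_ideal" by (intro relation_ideal.mult)
  have words: "?r \<in> words"
  proof -
    have m: "p * q \<in> words" if "p \<in> words" "q \<in> words" for p q
      using that keys_mult[of p q] unfolding words_def by (fastforce simp: plus_list_def)
    have gen: "word v \<in> words" "word w \<in> words"
      using vw V_subset_total by (auto simp: words_def)
    have sign: "(- 1) ^ k \<in> words" for k
    proof (induction k)
      case (Suc k)
      have "- 1 \<in> words" using \<open>1 \<in> words\<close> by (simp add: words_def)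
      then show ?case unfolding power_Suc using Suc by (rule m)
    qed (simp add: \<open>1 \<in> words\<close>)
    have diff: "p - q \<in> words" if "p \<in> words" "q \<in> words" for p q
      using that keys_diff[of p q] unfolding words_def by blast
    show ?thesis by (intro diff m gen sign)
  qed
  have "eval (\<lambda>v. v) ?r = 0"
    using ideal by (simp only: eval_kernel[OF words] mult_1_left mult_1_right)
  then show ?thesis using False by (simp add: eq_neg_iff_add_eq_0)
qed

lemma d_add: "d (x + y) = d x + d y" and d_scale: "d (c *q x) = c *q d x" and d_0 [simp]: "d 0 = 0"
  and d_diff: "d (x - y) = d x - d y"
proof -
  interpret d: Vector_Spaces.linear scale scale d by (rule linear_d)
  show "d (x + y) = d x + d y" "d (c *q x) = c *q d x" "d 0 = 0" "d (x - y) = d x - d y"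
    by (rule d.add d.scale d.zero d.diff)+
qed

lemma V_degree_part: "v \<in> V n \<Longrightarrow> v \<in> degree_part n"
  unfolding degree_part_def
  by (rule span_base, rule CollectI, rule exI[of _ "[v]"], rule exI[of _ "[n]"]) simp

lemma d_mult: assumes v: "v \<in> V n" shows "d (v * y) = d v * y - v * d y"
proof (cases "even n")
  case True
  then have "v = 0" using v odd_V by blast
  then show ?thesis by simp
qed (use leibniz[OF V_degree_part[OF v], of y] in simp)

lemma d_1: "d 1 = 0"
proof -
  have "1 \<in> degree_part 0"
    unfolding degree_part_def
    by (rule span_base, rule CollectI, rule exI[of _ "[]"], rule exI[of _ "[]"]) simp
  from leibniz[OF this, of 1] show ?thesis by simp
qed

section \<open>A homogeneous basis\<close>

definition basis_part :: "nat \<Rightarrow> 'a set"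
  where "basis_part n = (SOME C. C \<subseteq> V n \<and> independent C \<and> span C = V n)"

lemma basis_part: "basis_part n \<subseteq> V n" "independent (basis_part n)" "span (basis_part n) = V n"
proof -
  obtain C where "C \<subseteq> V n" "independent C" "V n \<subseteq> span C"
    by (rule maximal_independent_subset)
  then have "C \<subseteq> V n \<and> independent C \<and> span C = V n"
    using subspace_V[of n] by (simp add: span_minimal subset_antisym)
  then have "basis_part n \<subseteq> V n \<and> independent (basis_part n) \<and> span (basis_part n) = V n"
    unfolding basis_part_def by (rule someI)
  then show "basis_part n \<subseteq> V n" "independent (basis_part n)" "span (basis_part n) = V n"
    by blast+
qed

definition basis :: "'a set"
  where "basis = (\<Union>n. basis_part n)"

definition deg :: "'a \<Rightarrow> nat"
  where "deg b = (THE n. b \<in> V n)"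

lemma deg_eqI: assumes "v \<in> V n" "v \<noteq> 0" shows "deg v = n"
  unfolding deg_def
proof (rule the_equality)
  fix m assume m: "v \<in> V m"
  show "m = n"
  proof (rule ccontr)
    assume "m \<noteq> n"
    \<comment> \<open>The family with \<open>v\<close> in degree \<open>n\<close> and
      \<open>- v\<close> in degree \<open>m\<close> sums to zero, so directness kills its
      members.\<close>
    have "(if n = n then v else - v) = 0"
      by (rule direct_V[of "{m, n}" "\<lambda>k. if k = n then v else - v"])
        (use assms m \<open>m \<noteq> n\<close> subspace_V[of m] subspace_neg in auto)
    then show False using assms by simp
  qed
qed (rule assms)

lemma basis_part_nonzero: "b \<in> basis_part n \<Longrightarrow> b \<noteq> 0"
  using basis_part(2)[of n] dependent_zero[of "basis_part n"] by auto

lemma basis_nonzero: "b \<in> basis \<Longrightarrow> b \<noteq> 0"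
  by (auto simp: basis_def dest: basis_part_nonzero)

lemma deg_basis_part: "b \<in> basis_part n \<Longrightarrow> deg b = n"
  by (rule deg_eqI) (use basis_part(1)[of n] basis_part_nonzero in auto)

lemma basis_part_eq: "basis_part n = {b \<in> basis. deg b = n}"
  unfolding basis_def using deg_basis_part by auto

lemma basis_V: assumes "b \<in> basis" shows "b \<in> V (deg b)"
proof -
  have "b \<in> basis_part (deg b)" using assms by (simp add: basis_part_eq)
  then show ?thesis using basis_part(1) by blast
qed

lemma basis_deg_ge: "b \<in> basis \<Longrightarrow> 2 \<le> deg b"
  using basis_V[of b] basis_nonzero[of b] one_connected[of "deg b"] by (cases "deg b < 2") auto

text \<open>Directness splits a linear relation into its homogeneous parts, each of which is a
  relation inside one \<open>basis_part\<close>.\<close>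

lemma independent_basis: "independent basis"
  unfolding independent_explicit_finite_subsets
proof (intro allI impI ballI)
  fix F u w assume F: "F \<subseteq> basis" "finite F" "(\<Sum>v\<in>F. u v *q v) = 0" "w \<in> F"
  define part where "part n = {v\<in>F. deg v = n}" for n
  have sub: "part n \<subseteq> basis_part n" for n
    using F(1) by (auto simp: part_def basis_part_eq)
  have partV: "v \<in> V n" if "v \<in> part n" for v n
    using that sub basis_part(1) by blast
  have "(\<Sum>n\<in>deg ` F. \<Sum>v\<in>part n. u v *q v) = 0"
    unfolding part_def using F by (simp add: sum.group)
  then have "(\<Sum>v\<in>part (deg w). u v *q v) = 0"
    by (rule direct_V[rotated 2])
      (use F partV in \<open>auto intro!: subspace_sum subspace_scale subspace_V\<close>)
  then show "u w = 0"
    using basis_part(2)[of "deg w", unfolded independent_explicit_finite_subsets,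
        rule_format, OF sub, of u w] F by (auto simp: part_def)
qed

lemma span_basis: "span basis = total"
proof
  show "span basis \<subseteq> total"
    using basis_V V_subset_total by (intro span_minimal) (auto simp: total_def)
  have "V n \<subseteq> span basis" for n
    using basis_part(3)[of n] span_mono[of "basis_part n" basis] by (auto simp: basis_def)
  then show "total \<subseteq> span basis"
    unfolding total_def by (intro span_minimal) auto
qed

lemma finite_basis: "finite basis"
proof -
  obtain C where "finite C" "total \<subseteq> span C" using finite_dim_total by (auto simp: finite_dim_def)
  then show ?thesis
    using independent_span_bound[of C, OF _ independent_basis] span_basis span_superset[of basis]
    by auto
qed

lemma card_basis: "card basis = dim total"
  using basis_card_eq_dim[of basis total] independent_basis span_basis span_superset[of basis] by simp

abbreviation coord :: "'a \<Rightarrow> 'a \<Rightarrow> rat"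
  where "coord \<equiv> representation basis"

lemma coord_basis: "b \<in> basis \<Longrightarrow> coord b c = (if c = b then 1 else 0)"
  using representation_basis[OF independent_basis] by simp

lemma coord_V: assumes v: "v \<in> V n" and c: "coord v c \<noteq> 0" shows "deg c = n"
proof -
  have "coord v = representation (basis_part n) v"
    using v basis_part(3)[of n]
    by (intro representation_extend[OF independent_basis]) (auto simp: basis_def)
  then show ?thesis using c representation_ne_zero basis_part_eq by auto
qed

lemma sum_coord: "v \<in> total \<Longrightarrow> (\<Sum>b\<in>basis. coord v b *q b) = v"
  using finite_basis independent_basis span_basis
  by (intro sum_representation_eq) auto

section \<open>Contractions\<close>

text \<open>This is the antiderivation extending the coordinate functional of \<open>b\<close>, read
  off as the off-diagonal entry of a homomorphism into triangular matrices.\<close>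

lemma contraction_exists:
  assumes b: "b \<in> basis"
  shows "\<exists>h. Vector_Spaces.linear scale scale h \<and> h 1 = 0 \<and>
    (\<forall>v\<in>total. \<forall>y. h (v * y) = coord v b *q y - v * h y)"
proof -
  \<comment> \<open>The entry \<open>- v\<close> supplies the sign of the product rule and makes the
    off-diagonal entry of \<open>f v * f w\<close> antisymmetric in \<open>v\<close> and
    \<open>w\<close>, as the universal property requires for odd generators.\<close>
  define f where "f v = Upper (- v) (coord v b *q 1) v" for v
  define s where "s c A = Upper (c *q ul A) (c *q ur A) (c *q lr A)" for c :: rat and A :: "'a upper"
  have rep_add: "coord (v + w) b = coord v b + coord w b" if "v \<in> total" "w \<in> total" for v w
    using that by (simp add: representation_add independent_basis span_basis)
  have rep_scale: "coord (c *q v) b = c * coord v b" if "v \<in> total" for v c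
    using that by (simp add: representation_scale independent_basis span_basis)
  have comm: "f v * f w = (- 1) ^ (m * n) * (f w * f v)" if vw: "v \<in> V m" "w \<in> V n" for v w m n
  proof (cases "even m \<or> even n")
    case True
    have "f 0 = 0" by (simp add: f_def zero_upper_def representation_zero)
    moreover have "v = 0 \<or> w = 0" using True odd_V vw by blast
    ultimately show ?thesis by auto
  next
    case False
    have "f v * f w = - (f w * f v)"
      using anticommute[OF vw]
      by (simp add: f_def times_upper_def uminus_upper_def scale_mult_left scale_mult_right)
    then show ?thesis using False by simp
  qed
  have "\<exists>!h. Vector_Spaces.linear scale s h \<and> h 1 = 1 \<and> (\<forall>x y. h (x * y) = h x * h y) \<and>
      (\<forall>v\<in>total. h v = f v)"
  proof (rule universal_property)
    show "rat_algebra s" unfolding s_def[abs_def] by (rule rat_algebra_upper)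
    show "f (v + w) = f v + f w" if "v \<in> total" "w \<in> total" for v w
      using that by (simp add: f_def plus_upper_def rep_add scale_left_distrib)
    show "f (c *q v) = s c (f v)" if "v \<in> total" for c v
      using that by (simp add: f_def s_def rep_scale)
  qed (rule comm)
  then obtain h where h: "Vector_Spaces.linear scale s h" "h 1 = 1"
    "\<And>x y. h (x * y) = h x * h y" "\<And>v. v \<in> total \<Longrightarrow> h v = f v"
    by blast
  interpret h: Vector_Spaces.linear scale s h by (rule h(1))
  \<comment> \<open>Because the lower right entry is the identity, the off-diagonal entry of
    \<open>h v * h y\<close> is \<open>coord v b *q y - v * ur (h y)\<close>.\<close>
  have lr: "lr (h x) = x" for x
  proof (induction x rule: Lambda_induct)
    case one
    then show ?case by (simp add: h one_upper_def)
  next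
    case (mult v n y)
    then show ?case using V_subset_total[of v n] by (simp add: h f_def times_upper_def)
  next
    case (add x y)
    then show ?case by (simp add: h.add plus_upper_def)
  next
    case (scale c x)
    then show ?case by (simp add: h.scale s_def)
  qed
  have "Vector_Spaces.linear scale scale (\<lambda>x. ur (h x))"
    by unfold_locales (simp_all add: h.add h.scale plus_upper_def s_def)
  moreover have "ur (h 1) = 0" by (simp add: h one_upper_def)
  moreover have "ur (h (v * y)) = coord v b *q y - v * ur (h y)" if "v \<in> total" for v y
    using that by (simp add: h f_def times_upper_def lr scale_mult_left)
  ultimately show ?thesis by (intro exI[of _ "\<lambda>x. ur (h x)"]) simp
qed

definition contraction :: "'a \<Rightarrow> 'a \<Rightarrow> 'a"
  where "contraction b = (SOME h. Vector_Spaces.linear scale scale h \<and> h 1 = 0 \<and>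
    (\<forall>v\<in>total. \<forall>y. h (v * y) = coord v b *q y - v * h y))"

lemma contraction:
  assumes "b \<in> basis"
  shows linear_contraction: "Vector_Spaces.linear scale scale (contraction b)"
    and contraction_1: "contraction b 1 = 0"
    and contraction_mult: "v \<in> total \<Longrightarrow> contraction b (v * y) = coord v b *q y - v * contraction b y"
proof -
  have ex: "Vector_Spaces.linear scale scale (contraction b) \<and> contraction b 1 = 0 \<and>
    (\<forall>v\<in>total. \<forall>y. contraction b (v * y) = coord v b *q y - v * contraction b y)"
    using someI_ex[OF contraction_exists[OF assms]] unfolding contraction_def .
  then show "Vector_Spaces.linear scale scale (contraction b)" "contraction b 1 = 0"
    "v \<in> total \<Longrightarrow> contraction b (v * y) = coord v b *q y - v * contraction b y"
    by simp_all
qed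

lemma contraction_basis_mult:
  assumes "b \<in> basis" "c \<in> basis"
  shows "contraction b (c * y) = (if b = c then y else 0) - c * contraction b y"
  using contraction_mult[OF assms(1), of c y] coord_basis[OF assms(2)] V_subset_total[OF basis_V[OF assms(2)]]
  by simp

lemma
  assumes "b \<in> basis"
  shows contraction_add: "contraction b (x + y) = contraction b x + contraction b y"
    and contraction_scale: "contraction b (c *q x) = c *q contraction b x"
    and contraction_0: "contraction b 0 = 0"
proof -
  interpret h: Vector_Spaces.linear scale scale "contraction b"
    using assms by (rule linear_contraction)
  show "contraction b (x + y) = contraction b x + contraction b y"
    "contraction b (c *q x) = c *q contraction b x" "contraction b 0 = 0"
    by (rule h.add h.scale h.zero)+
qed

text \<open>Contracting \<open>b * y = 0\<close> gives \<open>y - b * contraction b y = 0\<close>.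
  Thus the kernel of multiplication by \<open>b\<close> lies in its image, with an explicit
  preimage.\<close>

lemma basis_mult_eq_0:
  assumes "b \<in> basis" "b * y = 0"
  shows "y = b * contraction b y"
  using contraction_basis_mult[OF assms(1,1), of y] assms by (simp add: contraction_0)

section \<open>The bigrading by wordlength and degree\<close>

text \<open>
  A homomorphism into the group algebra of \<open>int \<times> int\<close> over \<open>\<Lambda>V\<close> whose coefficients are the
  projections onto the bihomogeneous parts.
\<close>

lemma bigrading_exists:
  "\<exists>h. Vector_Spaces.linear scale (\<lambda>c p. Poly_Mapping.single 0 (c *q 1) * p) h \<and> h 1 = 1 \<and>
    (\<forall>x y. h (x * y) = h x * h y) \<and>
    (\<forall>n. \<forall>v\<in>V n. h v = Poly_Mapping.single (1 :: int, int n) v)"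
proof -
  define s where "s c p = Poly_Mapping.single 0 (c *q 1) * p" for c and p :: "int \<times> int \<Rightarrow>\<^sub>0 'a"
  \<comment> \<open>Elements of \<open>total\<close> need not be homogeneous, so every coordinate
    carries the degree of its own basis element; on \<open>V n\<close> the sum collapses to one
    monomial.\<close>
  define f where "f v = (\<Sum>b\<in>basis. Poly_Mapping.single (1 :: int, int (deg b)) (coord v b *q b))" for v
  have fV: "f v = Poly_Mapping.single (1, int n) v" if v: "v \<in> V n" for v n
  proof -
    have "f v = (\<Sum>b\<in>basis. Poly_Mapping.single (1, int n) (coord v b *q b))"
      unfolding f_def using coord_V[OF v] by (intro sum.cong refl) force
    also have "\<dots> = Poly_Mapping.single (1, int n) (\<Sum>b\<in>basis. coord v b *q b)"
      using sum_comp_morphism[of "Poly_Mapping.single (1, int n)" "\<lambda>b. coord v b *q b" basis]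
      by (simp add: single_add o_def)
    finally show ?thesis using sum_coord V_subset_total[OF v] by simp
  qed
  have "\<exists>!h. Vector_Spaces.linear scale s h \<and> h 1 = 1 \<and> (\<forall>x y. h (x * y) = h x * h y) \<and>
      (\<forall>v\<in>total. h v = f v)"
  proof (rule universal_property)
    show "rat_algebra s" unfolding s_def[abs_def] by (rule rat_algebra_poly_mapping)
    show "f (v + w) = f v + f w" if "v \<in> total" "w \<in> total" for v w
      using that
      by (simp add: f_def representation_add independent_basis span_basis scale_left_distrib
          single_add sum.distrib)
    show "f (c *q v) = s c (f v)" if "v \<in> total" for c v
      using that
      by (simp add: f_def s_def representation_scale independent_basis span_basis sum_distrib_left
          mult_single scale_mult_left)
    show "f v * f w = (- 1) ^ (m * n) * (f w * f v)" if vw: "v \<in> V m" "w \<in> V n" for v w m n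
    proof (cases "even m \<or> even n")
      case True
      then have "v = 0 \<or> w = 0" using odd_V vw by blast
      then show ?thesis using fV[OF vw(1)] fV[OF vw(2)] by auto
    next
      case False
      have "f v * f w = - (f w * f v)"
        using anticommute[OF vw]
        by (simp add: fV[OF vw(1)] fV[OF vw(2)] mult_single single_uminus add.commute)
      then show ?thesis using False by simp
    qed
  qed
  then obtain h where h: "Vector_Spaces.linear scale s h \<and> h 1 = 1 \<and>
      (\<forall>x y. h (x * y) = h x * h y) \<and> (\<forall>v\<in>total. h v = f v)"
    by blast
  then have "\<forall>n. \<forall>v\<in>V n. h v = Poly_Mapping.single (1 :: int, int n) v"
    using fV V_subset_total by simp
  then show ?thesis using h unfolding s_def[abs_def] by blast
qed

definition bigrading :: "'a \<Rightarrow> int \<times> int \<Rightarrow>\<^sub>0 'a"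
  where "bigrading = (SOME h. Vector_Spaces.linear scale (\<lambda>c p. Poly_Mapping.single 0 (c *q 1) * p) h \<and>
    h 1 = 1 \<and> (\<forall>x y. h (x * y) = h x * h y) \<and>
    (\<forall>n. \<forall>v\<in>V n. h v = Poly_Mapping.single (1 :: int, int n) v))"

definition proj :: "int \<times> int \<Rightarrow> 'a \<Rightarrow> 'a"
  where "proj g x = Poly_Mapping.lookup (bigrading x) g"

text \<open>The index is the pair of wordlength and degree. Being integral, it allows shifts such as
  \<open>(i - 1, p - 1)\<close> without truncation.\<close>

definition part :: "int \<times> int \<Rightarrow> 'a set"
  where "part g = {x. \<forall>k. proj k x = (if k = g then x else 0)}"

lemma proj_1: "proj g 1 = (if g = 0 then 1 else 0)"
  and proj_mult_V: "v \<in> V n \<Longrightarrow> proj g (v * y) = v * proj (g - (1, int n)) y"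
  and proj_add: "proj g (x + y) = proj g x + proj g y"
  and proj_scale: "proj g (c *q x) = c *q proj g x"
  and proj_mult_part: "x \<in> part k \<Longrightarrow> proj g (x * y) = x * proj (g - k) y"
proof -
  have ex: "Vector_Spaces.linear scale (\<lambda>c p. Poly_Mapping.single 0 (c *q 1) * p) bigrading \<and>
      bigrading 1 = 1 \<and> (\<forall>x y. bigrading (x * y) = bigrading x * bigrading y) \<and>
      (\<forall>n. \<forall>v\<in>V n. bigrading v = Poly_Mapping.single (1 :: int, int n) v)"
    using someI_ex[OF bigrading_exists] unfolding bigrading_def .
  have h: "Vector_Spaces.linear scale (\<lambda>c p. Poly_Mapping.single 0 (c *q 1) * p) bigrading"
    "bigrading 1 = 1" "\<And>x y. bigrading (x * y) = bigrading x * bigrading y"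
    "\<And>n v. v \<in> V n \<Longrightarrow> bigrading v = Poly_Mapping.single (1 :: int, int n) v"
    using ex by simp_all
  interpret h: Vector_Spaces.linear scale "\<lambda>c p. Poly_Mapping.single 0 (c *q 1) * p" bigrading
    by (rule h(1))
  show "proj g 1 = (if g = 0 then 1 else 0)"
    by (simp add: proj_def h(2) lookup_one when_def)
  show "v \<in> V n \<Longrightarrow> proj g (v * y) = v * proj (g - (1, int n)) y"
    by (simp add: proj_def h(3,4) lookup_single_times)
  show "proj g (x + y) = proj g x + proj g y"
    by (simp add: proj_def h.add lookup_add)
  show "proj g (c *q x) = c *q proj g x"
    by (simp add: proj_def h.scale lookup_single_times scale_mult_left)
  show "proj g (x * y) = x * proj (g - k) y" if "x \<in> part k"
  proof -
    have "bigrading x = Poly_Mapping.single k x"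
      by (rule poly_mapping_eqI) (use that in \<open>simp add: part_def proj_def lookup_single when_def del: split_paired_All\<close>)
    then show ?thesis by (simp add: proj_def h(3) lookup_single_times)
  qed
qed

lemma proj_0 [simp]: "proj g 0 = 0"
  using proj_scale[of g 0 0] by simp

lemma proj_diff: "proj g (x - y) = proj g x - proj g y"
  using proj_add[of g "x - y" y] by simp

lemma proj_same: "x \<in> part g \<Longrightarrow> proj g x = x"
  and proj_other: "x \<in> part g \<Longrightarrow> k \<noteq> g \<Longrightarrow> proj k x = 0"
  by (simp_all add: part_def del: split_paired_All)

lemma subspace_part: "subspace (part g)"
  by (rule subspaceI) (auto simp: part_def proj_add proj_scale)

lemma proj_proj: "proj g (proj k x) = (if g = k then proj k x else 0)"
proof (induction x arbitrary: g k rule: Lambda_induct)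
  case one
  show ?case by (simp add: proj_1)
next
  case (mult v n y)
  then show ?case by (simp add: proj_mult_V)
qed (simp_all add: proj_add proj_scale)

lemma proj_part: "proj g x \<in> part g"
  by (simp add: part_def proj_proj)

text \<open>Quantifying over all finite supersets of \<open>F\<close> keeps the induction simple:
  \<open>F\<close> may be shifted for a product and enlarged to a union for a sum.\<close>

lemma sum_proj: "\<exists>F. finite F \<and> (\<forall>G. finite G \<longrightarrow> F \<subseteq> G \<longrightarrow> (\<Sum>g\<in>G. proj g x) = x)"
proof (induction x rule: Lambda_induct)
  case one
  have "(\<Sum>g\<in>G. proj g 1) = 1" if "finite G" "{0} \<subseteq> G" for G
    using that by (simp add: proj_1)
  then show ?case by blast
next
  case (mult v n y)
  define s where "s = (1 :: int, int n)"
  obtain F where F: "finite F" "\<And>G. finite G \<Longrightarrow> F \<subseteq> G \<Longrightarrow> (\<Sum>g\<in>G. proj g y) = y"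
    using mult by blast
  have "(\<Sum>g\<in>G. proj g (v * y)) = v * y" if G: "finite G" "(\<lambda>g. g + s) ` F \<subseteq> G" for G
  proof -
    have "(\<Sum>g\<in>G. proj g (v * y)) = v * (\<Sum>g\<in>G. proj (g - s) y)"
      by (simp add: proj_mult_V[OF mult(1)] s_def sum_distrib_left)
    also have "(\<Sum>g\<in>G. proj (g - s) y) = (\<Sum>g\<in>(\<lambda>g. g - s) ` G. proj g y)"
      by (subst sum.reindex) (auto simp: inj_on_def)
    also have "\<dots> = y"
    proof (rule F(2))
      show "F \<subseteq> (\<lambda>g. g - s) ` G"
      proof
        fix g assume "g \<in> F"
        then have "g + s \<in> G" using G by blast
        then have "(g + s) - s \<in> (\<lambda>g. g - s) ` G" by (rule imageI)
        then show "g \<in> (\<lambda>g. g - s) ` G" by simp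
      qed
    qed (use G in simp)
    finally show ?thesis .
  qed
  then show ?case using F(1) by (intro exI[of _ "(\<lambda>g. g + s) ` F"]) simp
next
  case (add x y)
  then obtain F F' where F: "finite F" "\<And>G. finite G \<Longrightarrow> F \<subseteq> G \<Longrightarrow> (\<Sum>g\<in>G. proj g x) = x"
    and F': "finite F'" "\<And>G. finite G \<Longrightarrow> F' \<subseteq> G \<Longrightarrow> (\<Sum>g\<in>G. proj g y) = y"
    by blast
  show ?case
    by (intro exI[of _ "F \<union> F'"]) (simp add: F F' proj_add sum.distrib)
next
  case (scale c x)
  then obtain F where F: "finite F" "\<And>G. finite G \<Longrightarrow> F \<subseteq> G \<Longrightarrow> (\<Sum>g\<in>G. proj g x) = x"
    by blast
  then show ?case
    by (intro exI[of _ F]) (simp add: proj_scale scale_sum_right[symmetric])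
qed

lemma partI:
  assumes "\<And>k. k \<noteq> g \<Longrightarrow> proj k x = 0"
  shows "x \<in> part g"
proof -
  obtain F where F: "finite F" "\<And>G. finite G \<Longrightarrow> F \<subseteq> G \<Longrightarrow> (\<Sum>k\<in>G. proj k x) = x"
    using sum_proj[of x] by blast
  have "x = (\<Sum>k\<in>insert g F. proj k x)"
    using F(1) by (intro F(2)[symmetric]) auto
  also have "\<dots> = proj g x"
    using F(1) assms by (intro trans[OF sum.mono_neutral_right[of "insert g F" "{g}"]]) auto
  finally show ?thesis using assms by (simp add: part_def)
qed

lemma part_mult_V: "v \<in> V n \<Longrightarrow> y \<in> part g \<Longrightarrow> v * y \<in> part (g + (1, int n))"
  by (rule partI) (auto simp: proj_mult_V intro!: proj_other arg_cong[of _ 0 "(*) v", simplified])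

lemma prod_list_part:
  "list_all2 (\<lambda>v k. v \<in> V k) vs ns \<Longrightarrow> prod_list vs \<in> part (int (length vs), int (sum_list ns))"
proof (induction rule: list_all2_induct)
  case Nil
  show ?case by (simp add: part_def proj_1 zero_prod_def)
next
  case (Cons v vs n ns)
  then show ?case using part_mult_V[OF Cons(1,3)] by (simp add: add.commute)
qed

text \<open>Coformality speaks of \<open>Lambda 2\<close> and the degree axiom of
  \<open>degree_part\<close>; this lemma and the next translate both into vanishing
  projections.\<close>

lemma proj_length:
  assumes "x \<in> Lambda k" "fst g \<noteq> int k"
  shows "proj g x = 0"
proof -
  have total: "\<forall>g. fst g \<noteq> i + 1 \<longrightarrow> proj g (v * y) = 0"
    if "v \<in> total" and y: "\<forall>g. fst g \<noteq> i \<longrightarrow> proj g y = 0" for v y i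
  proof -
    have "v \<in> {v. \<forall>g. fst g \<noteq> i + 1 \<longrightarrow> proj g (v * y) = 0}"
      using that(1) unfolding total_def
    proof (rule span_subspace_induct)
      show "subspace {v. \<forall>g. fst g \<noteq> i + 1 \<longrightarrow> proj g (v * y) = 0}"
        by (rule subspaceI) (simp_all add: distrib_right proj_add scale_mult_left proj_scale)
    next
      fix v assume "v \<in> (\<Union>n. V n)"
      then obtain n where "v \<in> V n" by blast
      then show "v \<in> {v. \<forall>g. fst g \<noteq> i + 1 \<longrightarrow> proj g (v * y) = 0}"
        using y by (simp add: proj_mult_V)
    qed
    then show ?thesis by simp
  qed
  have prod: "\<forall>g. fst g \<noteq> int (length vs) \<longrightarrow> proj g (prod_list vs) = 0"
    if "set vs \<subseteq> total" for vs
    using that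
  proof (induction vs)
    case Nil
    show ?case by (auto simp: proj_1 zero_prod_def)
  next
    case (Cons v vs)
    then show ?case using total[of v "int (length vs)" "prod_list vs"]
      by (simp add: add.commute del: split_paired_All)
  qed
  have "subspace {x. proj g x = 0}"
    by (rule subspaceI) (simp_all add: proj_add proj_scale)
  then have "Lambda k \<subseteq> {x. proj g x = 0}"
    unfolding Lambda_def by (intro span_minimal) (use prod assms(2) in \<open>auto simp del: split_paired_All\<close>)
  then show ?thesis using assms(1) by blast
qed

lemma proj_degree:
  assumes "x \<in> degree_part n" "snd g \<noteq> int n"
  shows "proj g x = 0"
proof -
  have "subspace {x. proj g x = 0}"
    by (rule subspaceI) (simp_all add: proj_add proj_scale)
  then have "degree_part n \<subseteq> {x. proj g x = 0}"
    unfolding degree_part_def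
  proof (intro span_minimal subsetI CollectI)
    fix x assume "x \<in> {prod_list vs | vs ns. list_all2 (\<lambda>v k. v \<in> V k) vs ns \<and> sum_list ns = n}"
    then obtain vs ns where x: "x = prod_list vs" "list_all2 (\<lambda>v k. v \<in> V k) vs ns" "sum_list ns = n"
      by blast
    show "proj g x = 0"
      unfolding x(1) by (rule proj_other[OF prod_list_part[OF x(2)]]) (use x(3) assms(2) in auto)
  qed
  then show ?thesis using assms(1) by blast
qed

section \<open>Bidegrees of the differential and of the contractions\<close>

lemma d_V_degree: "v \<in> V n \<Longrightarrow> d v \<in> degree_part (Suc n)"
  using degree_d[of n] V_degree_part by blast

text \<open>Coformality enters here: it fixes the wordlength, while the degree axiom fixes the
  degree.\<close>

lemma d_V_part:
  assumes v: "v \<in> V n"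
  shows "d v \<in> part (2, int n + 1)"
proof (rule partI)
  fix k :: "int \<times> int" assume "k \<noteq> (2, int n + 1)"
  then have "fst k \<noteq> int 2 \<or> snd k \<noteq> int (Suc n)" by (auto simp: prod_eq_iff)
  moreover have "d v \<in> Lambda 2" using coformal V_subset_total[OF v] by blast
  ultimately show "proj k (d v) = 0"
    using proj_length[of "d v" 2 k] proj_degree[OF d_V_degree[OF v], of k] by blast
qed

text \<open>On generators this is \<open>d_V_part\<close>, and the product rule propagates it:
  \<open>d\<close> has bidegree \<open>(1, 1)\<close>, so the cohomology inherits both
  gradings.\<close>

lemma proj_d: "proj g (d x) = d (proj (g - (1, 1)) x)"
proof (induction x arbitrary: g rule: Lambda_induct)
  case one
  show ?case by (simp add: proj_1 d_1)
next
  case (mult v n y)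
  have eq: "g - (2, int n + 1) = g - (1, 1) - (1, int n)" "g - (1, int n) - (1, 1) = g - (1, 1) - (1, int n)"
    by (simp_all add: prod_eq_iff)
  show ?case
    by (simp only: d_mult[OF mult(1)] proj_diff proj_mult_part[OF d_V_part[OF mult(1)]]
        proj_mult_V[OF mult(1)] mult(2) eq)
qed (simp_all add: d_add d_scale proj_add proj_scale)

lemma d_part: "x \<in> part (i - 1, p - 1) \<Longrightarrow> d x \<in> part (i, p)"
  by (rule partI) (subst proj_d, subst proj_other, auto simp: prod_eq_iff)

lemma proj_contraction:
  assumes b: "b \<in> basis"
  shows "proj g (contraction b x) = contraction b (proj (g + (1, int (deg b))) x)"
proof (induction x arbitrary: g rule: Lambda_induct)
  case one
  show ?case by (simp add: proj_1 contraction_1[OF b] contraction_0[OF b])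
next
  case (mult v n y)
  have v: "v \<in> total" using V_subset_total mult(1) .
  \<comment> \<open>A nonzero coordinate forces \<open>n = deg b\<close>, and then the two shifts
    cancel.\<close>
  have 1: "coord v b *q proj g y = coord v b *q proj (g + (1, int (deg b)) - (1, int n)) y"
    using coord_V[OF mult(1), of b] by (cases "coord v b = 0") auto
  have 2: "g - (1, int n) + (1, int (deg b)) = g + (1, int (deg b)) - (1, int n)"
    by (simp add: prod_eq_iff)
  show ?case
    by (simp only: contraction_mult[OF b v] proj_diff proj_scale proj_mult_V[OF mult(1)] mult(2) 1 2)
qed (simp_all add: contraction_add[OF b] contraction_scale[OF b] proj_add proj_scale)

lemma contraction_part:
  assumes b: "b \<in> basis" and x: "x \<in> part (i, p)"
  shows "contraction b x \<in> part (i - 1, p - int (deg b))"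
  by (rule partI) (subst proj_contraction[OF b], subst proj_other[OF x],
      auto simp: prod_eq_iff contraction_0[OF b])

lemma basis_mult_part:
  assumes "b \<in> basis" "x \<in> part (i, p)"
  shows "b * x \<in> part (i + 1, p + int (deg b))"
  using part_mult_V[OF basis_V[OF assms(1)] assms(2)] by simp

section \<open>Bounds on the degree in a given wordlength\<close>

definition maxdeg :: nat
  where "maxdeg = Max (insert 0 (deg ` basis))"

lemma le_maxdeg: assumes "v \<in> V n" "v \<noteq> 0" shows "n \<le> maxdeg"
proof -
  have "basis_part n \<noteq> {}" using basis_part(3)[of n] assms by auto
  then obtain b where "b \<in> basis" "deg b = n" by (auto simp: basis_part_eq)
  then show ?thesis unfolding maxdeg_def using finite_basis by (intro Max_ge) auto
qed

text \<open>Each factor adds 1 to the wordlength and at most \<open>maxdeg\<close> to the degree.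
  These bounds make the later descents terminate.\<close>

lemma part_bounds:
  assumes "x \<in> part (i, p)" "x \<noteq> 0"
  shows "0 \<le> p" "p \<le> i * int maxdeg"
proof -
  define G where "G = {(i, p). 0 \<le> i \<and> 0 \<le> p \<and> p \<le> i * int maxdeg}"
  have "proj g x = 0" if "g \<notin> G" for g x
    using that
  proof (induction x arbitrary: g rule: Lambda_induct)
    case one
    then show ?case by (auto simp: proj_1 G_def zero_prod_def)
  next
    case (mult v n y)
    show ?case
    proof (cases "v = 0")
      case False
      then have "n \<le> maxdeg" using le_maxdeg mult(1) by blast
      then have "g - (1, int n) \<notin> G"
        using mult(3) by (cases g) (auto simp: G_def algebra_simps)
      then show ?thesis using mult(2) by (simp add: proj_mult_V[OF mult(1)])
    qed simp
  qed (simp_all add: proj_add proj_scale)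
  then have "(i, p) \<in> G" using assms proj_same[OF assms(1)] by metis
  then show "0 \<le> p" "p \<le> i * int maxdeg" by (simp_all add: G_def)
qed

section \<open>Consequences of anticommutation\<close>

lemma basis_anticommute: "b \<in> basis \<Longrightarrow> c \<in> basis \<Longrightarrow> b * c = - (c * b)"
  using anticommute basis_V by blast

lemma eq_minus_self:
  assumes "x = - x" shows "(x :: 'a) = 0"
proof -
  have "2 *q x = x + x" using scale_left_distrib[of 1 1 x] by simp
  also have "\<dots> = 0" using assms by (metis add.right_inverse)
  finally show ?thesis by simp
qed

lemma basis_square: "b \<in> basis \<Longrightarrow> b * b = 0"
  using basis_anticommute by (blast intro: eq_minus_self)

lemma basis_swap: "b \<in> basis \<Longrightarrow> c \<in> basis \<Longrightarrow> b * (c * y) = - (c * (b * y))"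
  using basis_anticommute[of b c] by (metis mult.assoc mult_minus_left)

lemma basis_square_mult: "b \<in> basis \<Longrightarrow> b * (b * y) = 0"
  using basis_square[of b] by (metis mult.assoc mult_zero_left)

lemma V_mult_eq_0:
  assumes "v \<in> V n" "\<And>b. b \<in> basis \<Longrightarrow> deg b = n \<Longrightarrow> b * y = 0"
  shows "v * y = 0"
proof -
  have "subspace {v. v * y = 0}"
    by (rule subspaceI) (simp_all add: distrib_right scale_mult_left)
  then have "span (basis_part n) \<subseteq> {v. v * y = 0}"
    by (intro span_minimal) (use assms(2) in \<open>auto simp: basis_part_eq\<close>)
  then show ?thesis using assms(1) basis_part(3)[of n] by blast
qed

text \<open>
  Since all generators have degree at least 2, the quadratic part of degree \<open>n + 1\<close> only involves
  generators of degree less than \<open>n\<close>.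
\<close>

lemma d_V_mult_eq_0:
  assumes v: "v \<in> V n" and y: "\<And>b. b \<in> basis \<Longrightarrow> deg b < n \<Longrightarrow> b * y = 0"
  shows "d v * y = 0"
proof -
  \<comment> \<open>\<open>degree_part (Suc n)\<close> contains words of every length. Projecting to
    the bidegree \<open>g\<close> of \<open>d v\<close> leaves only the words of length two to
    treat.\<close>
  define g where "g = (2 :: int, int n + 1)"
  have low: "w * y = 0" if "w \<in> V k" "k < n" for w k
    using that y by (intro V_mult_eq_0[of w k]) auto
  have "subspace {x. proj g x * y = 0}"
    by (rule subspaceI) (simp_all add: proj_add proj_scale distrib_right scale_mult_left)
  then have "degree_part (Suc n) \<subseteq> {x. proj g x * y = 0}"
    unfolding degree_part_def
  proof (intro span_minimal subsetI CollectI)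
    fix x assume "x \<in> {prod_list vs | vs ns. list_all2 (\<lambda>v k. v \<in> V k) vs ns \<and> sum_list ns = Suc n}"
    then obtain vs ns where x: "x = prod_list vs" "list_all2 (\<lambda>v k. v \<in> V k) vs ns" "sum_list ns = Suc n"
      by blast
    note part = prod_list_part[OF x(2), folded x(1), unfolded x(3)]
    show "proj g x * y = 0"
    proof (cases "length vs = 2")
      case False
      then have "proj g x = 0" using proj_other[OF part, of g] by (simp add: g_def)
      then show ?thesis by simp
    next
      case True
      then have "proj g x = x" using proj_same[OF part] by (simp add: g_def add.commute)
      moreover have "x * y = 0"
      proof -
        obtain v1 v2 where vs: "vs = [v1, v2]"
          using True by (auto simp: length_Suc_conv numeral_2_eq_2)
        then obtain a c where ns: "v1 \<in> V a" "v2 \<in> V c" "a + c = Suc n"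
          using x(2,3) by (auto simp: list_all2_Cons1)
        \<comment> \<open>Since \<open>a + c = n + 1\<close>, either \<open>a < 2\<close> and
          \<open>v1 = 0\<close>, or \<open>c < n\<close> and \<open>v2\<close> kills
          \<open>y\<close>.\<close>
        show ?thesis
        proof (cases "a < 2")
          case True
          then show ?thesis using ns(1) one_connected x(1) vs by simp
        next
          case False
          then have "v2 * y = 0" using ns by (intro low[of v2 c]) auto
          then show ?thesis using x(1) vs by (simp add: mult.assoc)
        qed
      qed
      ultimately show ?thesis by simp
    qed
  qed
  then have "proj g (d v) * y = 0" using d_V_degree[OF v] by blast
  then show ?thesis using proj_same[OF d_V_part[OF v]] by (simp add: g_def)
qed

section \<open>Annihilators of sets of generators\<close>

definition annihilator :: "'a set \<Rightarrow> 'a set"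
  where "annihilator S = {y. \<forall>b\<in>S. b * y = 0}"

text \<open>The inequality of degrees is strict, so basis elements of equal degree may be added one
  at a time in any order.\<close>

definition down_closed :: "'a set \<Rightarrow> bool"
  where "down_closed S \<longleftrightarrow> S \<subseteq> basis \<and> (\<forall>b\<in>S. \<forall>c\<in>basis. deg c < deg b \<longrightarrow> c \<in> S)"

text \<open>By the product rule \<open>b * d y = d b * y - d (b * y)\<close>. The last term is zero,
  and \<open>d b\<close> kills \<open>y\<close> because the generators of degree below
  \<open>deg b\<close> lie in \<open>S\<close>.\<close>

lemma d_annihilator:
  assumes "down_closed S" "y \<in> annihilator S"
  shows "d y \<in> annihilator S"
  unfolding annihilator_def
proof (intro CollectI ballI)
  fix b assume b: "b \<in> S"
  then have bb: "b \<in> basis" using assms(1) by (auto simp: down_closed_def)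
  have "d b * y = 0"
    using assms b by (intro d_V_mult_eq_0[OF basis_V[OF bb]]) (auto simp: down_closed_def annihilator_def)
  moreover have "b * y = 0" using assms(2) b by (simp add: annihilator_def)
  ultimately show "b * d y = 0" using d_mult[OF basis_V[OF bb], of y] by simp
qed

text \<open>Contraction with \<open>b\<close> anticommutes with multiplication by any other basis
  element. With \<open>basis_mult_eq_0\<close>, this yields preimages under multiplication by
  \<open>b\<close> that stay inside the annihilator.\<close>

lemma contraction_annihilator:
  assumes b: "b \<in> basis" "b \<notin> S" and S: "S \<subseteq> basis" and y: "y \<in> annihilator S"
  shows "contraction b y \<in> annihilator S"
  unfolding annihilator_def
proof (intro CollectI ballI)
  fix c assume c: "c \<in> S"
  then have "c * y = 0" using y by (simp add: annihilator_def)
  then have "contraction b (c * y) = 0" using b by (simp add: contraction_0)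
  moreover have "b \<noteq> c" using b c by blast
  ultimately show "c * contraction b y = 0"
    using contraction_basis_mult[of b c y] b c S by auto
qed

lemma annihilator_diff: "x \<in> annihilator S \<Longrightarrow> y \<in> annihilator S \<Longrightarrow> x - y \<in> annihilator S"
  by (simp add: annihilator_def right_diff_distrib)

lemma annihilator_add: "x \<in> annihilator S \<Longrightarrow> y \<in> annihilator S \<Longrightarrow> x + y \<in> annihilator S"
  by (simp add: annihilator_def distrib_left)

lemma annihilator_insert: "y \<in> annihilator (insert b S) \<longleftrightarrow> b * y = 0 \<and> y \<in> annihilator S"
  by (auto simp: annihilator_def)

lemma basis_mult_annihilator:
  assumes "b \<in> basis" "S \<subseteq> basis" "y \<in> annihilator S"
  shows "b * y \<in> annihilator (insert b S)"
  using assms by (auto simp: annihilator_def basis_square_mult basis_swap[of _ b])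

text \<open>
  The cohomology of the subcomplex \<open>annihilator S\<close> is nonzero in wordlength \<open>i\<close> and degree \<open>p\<close>.
\<close>

definition nontrivial :: "'a set \<Rightarrow> int \<Rightarrow> int \<Rightarrow> bool"
  where "nontrivial S i p \<longleftrightarrow> (\<exists>z \<in> annihilator S \<inter> part (i, p).
    d z = 0 \<and> (\<forall>m \<in> annihilator S \<inter> part (i - 1, p - 1). d m \<noteq> z))"

text \<open>Zero is a coboundary, so the representing cocycle is nonzero and
  \<open>part_bounds\<close> applies.\<close>

lemma nontrivial_bounds:
  assumes "nontrivial S i p"
  shows "0 \<le> p" "p \<le> i * int maxdeg"
proof -
  obtain z where z: "z \<in> part (i, p)" "\<forall>m \<in> annihilator S \<inter> part (i - 1, p - 1). d m \<noteq> z"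
    using assms by (auto simp: nontrivial_def)
  have "0 \<in> annihilator S \<inter> part (i - 1, p - 1)"
    by (simp add: annihilator_def subspace_0 subspace_part)
  then have "z \<noteq> 0" using z(2) by force
  then show "0 \<le> p" "p \<le> i * int maxdeg" using part_bounds z(1) by blast+
qed

text \<open>
  For \<open>S' = insert x S\<close>, multiplication by \<open>x\<close> maps \<open>annihilator S\<close> onto \<open>annihilator S'\<close> with kernel
  \<open>annihilator S'\<close>. The connecting homomorphism of the resulting long exact sequence preserves
  wordlength and lowers the degree, so it is nilpotent. This makes the following two descents work.
\<close>

lemma nontrivial_remove_lower:
  assumes S: "down_closed S" "down_closed (insert x S)" and x: "x \<in> basis" "x \<notin> S"
  shows "nontrivial (insert x S) (i + 1) p \<Longrightarrow> \<exists>p'. nontrivial S i p'"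
proof (induction "nat p" arbitrary: p rule: less_induct)
  case less
  let ?q = "int (deg x)"
  have q: "2 \<le> ?q" using basis_deg_ge[OF x(1)] by simp
  have SB: "S \<subseteq> basis" using S(1) by (simp add: down_closed_def)
  obtain z where z: "z \<in> annihilator (insert x S)" "z \<in> part (i + 1, p)" "d z = 0"
    and ne: "\<And>m. m \<in> annihilator (insert x S) \<Longrightarrow> m \<in> part (i, p - 1) \<Longrightarrow> d m \<noteq> z"
    using less.prems by (auto simp: nontrivial_def)
  \<comment> \<open>A lift of \<open>z\<close> along multiplication by \<open>x\<close>.\<close>
  define m where "m = contraction x z"
  have xz: "x * z = 0" "z \<in> annihilator S" using z(1) by (auto simp: annihilator_insert)
  have xm: "x * m = z" using basis_mult_eq_0[OF x(1) xz(1)] by (simp add: m_def)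
  have m: "m \<in> annihilator S" "m \<in> part (i, p - ?q)"
    using contraction_annihilator[OF x SB xz(2)] contraction_part[OF x(1) z(2)]
    by (simp_all add: m_def)
  \<comment> \<open>All generators of degree below \<open>deg x\<close> lie in \<open>S\<close>, so
    multiplication by \<open>x\<close> commutes with \<open>d\<close> up to sign on
    \<open>annihilator S\<close>.\<close>
  have dx: "d x * y = 0" if "y \<in> annihilator S" for y
    using that S(2) by (intro d_V_mult_eq_0[OF basis_V[OF x(1)]])
      (auto simp: down_closed_def annihilator_def)
  have dxm: "d (x * y) = - (x * d y)" if "y \<in> annihilator S" for y
    using d_mult[OF basis_V[OF x(1)], of y] dx[OF that] by simp
  \<comment> \<open>\<open>d m\<close> represents the image of the class of \<open>z\<close> under
    the connecting homomorphism.\<close>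
  have dm: "d m \<in> annihilator (insert x S)" "d m \<in> part (i + 1, p - ?q + 1)"
    using d_annihilator[OF S(1) m(1)] dxm[OF m(1)] xm z(3) d_part[of m "i + 1" "p - ?q + 1"] m(2)
    by (simp_all add: annihilator_insert)
  show ?case
  proof (cases "\<exists>m' \<in> annihilator (insert x S) \<inter> part (i, p - ?q). d m' = d m")
    case True
    then obtain m' where m': "m' \<in> annihilator (insert x S)" "m' \<in> part (i, p - ?q)" "d m' = d m"
      by blast
    have xm': "x * m' = 0" "m' \<in> annihilator S" using m'(1) by (auto simp: annihilator_insert)
    \<comment> \<open>The connecting image is a coboundary, so the lift can be corrected to the
      cocycle \<open>m - m'\<close>. A primitive of that, multiplied by \<open>x\<close>, would be a
      primitive of \<open>z\<close> up to sign.\<close>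
    have "nontrivial S i (p - ?q)"
      unfolding nontrivial_def
    proof (intro bexI[of _ "m - m'"] conjI ballI notI)
      show "m - m' \<in> annihilator S \<inter> part (i, p - ?q)"
        using m m'(2) xm'(2) annihilator_diff subspace_diff[OF subspace_part] by blast
      show "d (m - m') = 0" using m'(3) by (simp add: d_diff)
      fix m'' assume m'': "m'' \<in> annihilator S \<inter> part (i - 1, p - ?q - 1)" "d m'' = m - m'"
      have "z = x * d m''" using xm xm'(1) m''(2) by (simp add: right_diff_distrib)
      also have "\<dots> = d (x * (- m''))"
        using dxm[of m''] m''(1) d_diff[of 0 "x * m''"] by simp
      finally have "d (x * (- m'')) = z" ..
      moreover have mm: "- m'' \<in> annihilator S" "- m'' \<in> part (i - 1, p - ?q - 1)"
        using m''(1) subspace_neg[OF subspace_part] by (auto simp: annihilator_def)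
      ultimately show False
        using ne[of "x * (- m'')"] basis_mult_annihilator[OF x(1) SB mm(1)]
          basis_mult_part[OF x(1) mm(2)] by simp
    qed
    then show ?thesis by blast
  next
    case False
    \<comment> \<open>The connecting image is a nonzero class of the same wordlength whose degree is
      lower by \<open>deg x - 1\<close>, which is positive.\<close>
    then have nt: "nontrivial (insert x S) (i + 1) (p - ?q + 1)"
      unfolding nontrivial_def using dm by (intro bexI[of _ "d m"]) (auto simp: d_d)
    have "nat (p - ?q + 1) < nat p"
      using nontrivial_bounds(1)[OF nt] q by linarith
    then show ?thesis using less.hyps nt by blast
  qed
qed

text \<open>Now the connecting homomorphism is followed backwards: a class that dies in
  \<open>annihilator S\<close> is the image of a nonzero class of higher degree and equal
  wordlength. The upper degree bound ends this ascent.\<close>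

lemma nontrivial_remove_same:
  assumes S: "down_closed S" "down_closed (insert x S)" and x: "x \<in> basis" "x \<notin> S"
  shows "nontrivial (insert x S) i p \<Longrightarrow> \<exists>p'. nontrivial S i p'"
proof (induction "nat (i * int maxdeg - p)" arbitrary: p rule: less_induct)
  case less
  let ?q = "int (deg x)"
  have q: "2 \<le> ?q" using basis_deg_ge[OF x(1)] by simp
  have SB: "S \<subseteq> basis" using S(1) by (simp add: down_closed_def)
  obtain z where z: "z \<in> annihilator (insert x S)" "z \<in> part (i, p)" "d z = 0"
    and ne: "\<And>m. m \<in> annihilator (insert x S) \<Longrightarrow> m \<in> part (i - 1, p - 1) \<Longrightarrow> d m \<noteq> z"
    using less.prems by (auto simp: nontrivial_def)
  have xz: "x * z = 0" "z \<in> annihilator S" using z(1) by (auto simp: annihilator_insert)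
  have dx: "d x * y = 0" if "y \<in> annihilator S" for y
    using that S(2) by (intro d_V_mult_eq_0[OF basis_V[OF x(1)]])
      (auto simp: down_closed_def annihilator_def)
  have dxm: "d (x * y) = - (x * d y)" if "y \<in> annihilator S" for y
    using d_mult[OF basis_V[OF x(1)], of y] dx[OF that] by simp
  show ?case
  proof (cases "\<exists>m \<in> annihilator S \<inter> part (i - 1, p - 1). d m = z")
    case False
    then have "nontrivial S i p"
      unfolding nontrivial_def using z(2,3) xz(2) by (intro bexI[of _ z]) auto
    then show ?thesis by blast
  next
    case True
    then obtain m where m: "m \<in> annihilator S" "m \<in> part (i - 1, p - 1)" "d m = z" by blast
    have xm: "x * m \<in> annihilator (insert x S)" "x * m \<in> part (i, p - 1 + ?q)" "d (x * m) = 0"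
      using basis_mult_annihilator[OF x(1) SB m(1)] basis_mult_part[OF x(1) m(2)] dxm[OF m(1)] m(3) xz(1)
      by simp_all
    \<comment> \<open>If \<open>x * m = d m'\<close>, write \<open>m' = x * w\<close>. Then
      \<open>m + d w\<close> lies in the smaller annihilator and is a primitive of \<open>z\<close>,
      against the choice of \<open>z\<close>.\<close>
    have "\<not> (\<exists>m' \<in> annihilator (insert x S) \<inter> part (i - 1, p - 2 + ?q). d m' = x * m)"
    proof
      assume "\<exists>m' \<in> annihilator (insert x S) \<inter> part (i - 1, p - 2 + ?q). d m' = x * m"
      then obtain m' where m': "m' \<in> annihilator (insert x S)" "m' \<in> part (i - 1, p - 2 + ?q)"
        "d m' = x * m" by blast
      have xm': "x * m' = 0" "m' \<in> annihilator S" using m'(1) by (auto simp: annihilator_insert)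
      define w where "w = contraction x m'"
      have w: "w \<in> annihilator S" "w \<in> part (i - 2, p - 2)" "x * w = m'"
        using contraction_annihilator[OF x SB xm'(2)] contraction_part[OF x(1) m'(2)]
          basis_mult_eq_0[OF x(1) xm'(1)]
        by (simp_all add: w_def)
      have dw: "d w \<in> annihilator S" "d w \<in> part (i - 1, p - 1)"
        using d_annihilator[OF S(1) w(1)] d_part[of w "i - 1" "p - 1"] w(2) by simp_all
      have "x * m = - (x * d w)" using dxm[OF w(1)] w(3) m'(3) by simp
      then have "x * (m + d w) = 0" by (simp add: distrib_left)
      then have "m + d w \<in> annihilator (insert x S)"
        using annihilator_add[OF m(1) dw(1)] by (simp add: annihilator_insert)
      moreover have "m + d w \<in> part (i - 1, p - 1)"
        using m(2) dw(2) by (rule subspace_add[OF subspace_part])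
      moreover have "d (m + d w) = z" using m(3) by (simp add: d_add d_d)
      ultimately show False using ne by blast
    qed
    then have nt: "nontrivial (insert x S) i (p - 1 + ?q)"
      unfolding nontrivial_def using xm by (intro bexI[of _ "x * m"]) (auto simp: algebra_simps)
    have "nat (i * int maxdeg - (p - 1 + ?q)) < nat (i * int maxdeg - p)"
      using nontrivial_bounds(2)[OF nt] q by linarith
    then show ?thesis using less.hyps nt by blast
  qed
qed

section \<open>The top monomial and the annihilator of the whole basis\<close>

lemma annihilator_set_factor:
  "distinct bs \<Longrightarrow> set bs \<subseteq> basis \<Longrightarrow> y \<in> annihilator (set bs) \<Longrightarrow> \<exists>w. y = prod_list bs * w"
proof (induction bs arbitrary: y)
  case (Cons b bs)
  have b: "b \<in> basis" "b \<notin> set bs" "set bs \<subseteq> basis" using Cons.prems by auto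
  have y: "b * y = 0" "y \<in> annihilator (set bs)"
    using Cons.prems(3) by (auto simp: annihilator_insert)
  \<comment> \<open>Contraction splits off the factor \<open>b\<close> and leaves a cofactor that
    the remaining basis elements still annihilate.\<close>
  have "contraction b y \<in> annihilator (set bs)"
    using contraction_annihilator[OF b y(2)] .
  then obtain w where "contraction b y = prod_list bs * w"
    using Cons.IH Cons.prems by auto
  then have "y = prod_list (b # bs) * w"
    using basis_mult_eq_0[OF b(1) y(1)] by (simp add: mult.assoc)
  then show ?case ..
qed simp

lemma contraction_prod_list:
  assumes "b \<in> basis" "set bs \<subseteq> basis" "b \<notin> set bs"
  shows "contraction b (prod_list bs) = 0"
  using assms by (induction bs) (auto simp: contraction_1 contraction_basis_mult)

text \<open>Contracting with the first factor recovers the product of the others, down to 1.\<close>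

lemma prod_list_nonzero:
  "distinct bs \<Longrightarrow> set bs \<subseteq> basis \<Longrightarrow> prod_list bs \<noteq> 0"
proof (induction bs)
  case (Cons b bs)
  then have "contraction b (prod_list (b # bs)) = prod_list bs"
    using contraction_prod_list[of b bs] by (simp add: contraction_basis_mult)
  then show ?case using Cons contraction_0[of b] by auto
qed simp

lemma prod_list_annihilator:
  "set bs \<subseteq> basis \<Longrightarrow> prod_list bs \<in> annihilator (set bs)"
proof (induction bs)
  case (Cons b bs)
  then show ?case using basis_mult_annihilator[of b "set bs" "prod_list bs"] by simp
qed (simp add: annihilator_def)

text \<open>The sign is left open, since only the vanishing of the product is needed
  afterwards.\<close>

lemma prod_list_commute:
  "set bs \<subseteq> basis \<Longrightarrow> v \<in> V n \<Longrightarrow>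
    prod_list bs * v = v * prod_list bs \<or> prod_list bs * v = - (v * prod_list bs)"
proof (induction bs)
  case (Cons b bs)
  have "b * v = - (v * b)"
    using Cons.prems by (intro anticommute[OF basis_V]) auto
  then have bv: "b * (v * y) = - (v * (b * y))" for y
    by (metis mult.assoc mult_minus_left)
  have "prod_list bs * v = v * prod_list bs \<or> prod_list bs * v = - (v * prod_list bs)"
    using Cons by simp
  then show ?case by (auto simp: mult.assoc bv)
qed simp

text \<open>The annihilator of the whole basis is the line through the top monomial
  \<open>z\<close>. As \<open>d z = 0\<close>, the differential vanishes on this line, so
  \<open>z\<close> is not a coboundary in it.\<close>

lemma nontrivial_basis: "\<exists>p. nontrivial basis (int (card basis)) p"
proof -
  obtain bs where bs: "set bs = basis" "distinct bs"
    using finite_distinct_list[OF finite_basis] by blast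
  define z where "z = prod_list bs"
  have len: "length bs = card basis" using distinct_card[OF bs(2)] bs(1) by simp
  define p where "p = int (sum_list (map deg bs))"
  have z: "z \<noteq> 0" "z \<in> annihilator basis"
    using prod_list_nonzero[of bs] prod_list_annihilator[of bs] bs by (simp_all add: z_def)
  have "list_all2 (\<lambda>v k. v \<in> V k) bs (map deg bs)"
    using nth_mem[of _ bs] basis_V unfolding bs(1) by (simp add: list_all2_conv_all_nth)
  from prod_list_part[OF this] have zp: "z \<in> part (int (card basis), p)"
    by (simp add: z_def p_def len)
  have multiple: "\<exists>c. y = c *q z" if y: "y \<in> annihilator basis" for y
  proof -
    have "\<exists>c. z * w = c *q z" for w
    proof (induction w rule: Lambda_induct)
      case one
      show ?case by (rule exI[of _ 1]) simp
    next
      case (mult v n w)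
      have "v * z = 0"
        by (rule V_mult_eq_0[OF mult(1)]) (use z(2) in \<open>simp add: annihilator_def\<close>)
      then have "z * v = 0"
        using prod_list_commute[of bs v n] bs(1) mult(1) by (auto simp: z_def)
      then have "z * (v * w) = 0 *q z" by (simp add: mult.assoc[symmetric])
      then show ?case ..
    next
      case (add x y)
      then obtain a b where "z * x = a *q z" "z * y = b *q z" by blast
      then have "z * (x + y) = (a + b) *q z" by (simp add: distrib_left scale_left_distrib)
      then show ?case ..
    next
      case (scale c x)
      then obtain a where "z * x = a *q z" by blast
      then have "z * (c *q x) = (c * a) *q z" by (simp add: scale_mult_right)
      then show ?case ..
    qed
    then show ?thesis
      using annihilator_set_factor[OF bs(2), of y] bs(1) y unfolding z_def by force
  qed
  \<comment> \<open>\<open>d z\<close> is a multiple of \<open>z\<close> but has another bidegree,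
    so its component in the bidegree of \<open>z\<close> vanishes.\<close>
  have dz: "d z = 0"
  proof -
    have "down_closed basis" by (simp add: down_closed_def)
    then obtain c where c: "d z = c *q z"
      using multiple[OF d_annihilator[OF _ z(2)]] by blast
    have "d z \<in> part (int (card basis) + 1, p + 1)" using zp by (intro d_part) simp
    then have "proj (int (card basis), p) (d z) = 0" by (rule proj_other) simp
    then show ?thesis using c proj_same[OF zp] by (simp add: proj_scale)
  qed
  have "nontrivial basis (int (card basis)) p"
    unfolding nontrivial_def
  proof (intro bexI[of _ z] conjI ballI notI)
    fix m assume m: "m \<in> annihilator basis \<inter> part (int (card basis) - 1, p - 1)" "d m = z"
    then obtain c where "m = c *q z" using multiple[of m] by blast
    then show False using m(2) dz z(1) by (simp add: d_scale)
  qed (use z zp dz in auto)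
  then show ?thesis ..
qed

section \<open>Descent from the full basis to the empty set, and the count of classes\<close>

lemma nontrivial_down_closed:
  "down_closed S \<Longrightarrow> card S \<le> i \<Longrightarrow> i \<le> card basis \<Longrightarrow> \<exists>p. nontrivial S (int i) p"
proof (induction "card (basis - S)" arbitrary: S i)
  case 0
  then have "S = basis" using finite_basis by (auto simp: down_closed_def)
  then show ?case using 0 nontrivial_basis by simp
next
  case (Suc k)
  have SB: "S \<subseteq> basis" using Suc.prems(1) by (simp add: down_closed_def)
  have fin: "finite (basis - S)" "finite S" using finite_basis SB finite_subset by auto
  have "basis - S \<noteq> {}" using Suc.hyps(2) by (metis card.empty nat.distinct(1))
  \<comment> \<open>An element of least degree outside \<open>S\<close> keeps the enlarged set
    down-closed.\<close>
  then obtain x where x: "x \<in> basis - S" "\<And>c. c \<in> basis - S \<Longrightarrow> deg x \<le> deg c"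
    using ex_min_if_finite[of "deg ` (basis - S)"] fin
    by (metis (no_types, lifting) arg_min_if_finite(1) arg_min_least)
  have down: "down_closed (insert x S)"
    using x Suc.prems(1) unfolding down_closed_def by (auto simp: not_less[symmetric])
  have "k = card (basis - insert x S)"
    using Suc.hyps(2) x(1) fin by (simp add: Diff_insert[of basis x S])
  note IH = Suc.hyps(1)[OF this down]
  have card: "card (insert x S) = Suc (card S)" using x(1) fin by simp
  have "card (insert x S) \<le> card basis"
    using x(1) SB finite_basis by (intro card_mono) auto
  \<comment> \<open>The induction hypothesis covers the wordlengths from \<open>card S + 1\<close>
    on; only wordlength \<open>card S\<close> itself has to come from the wordlength above.\<close>
  show ?case
  proof (cases "i = card S")
    case True
    then obtain p where "nontrivial (insert x S) (int i + 1) p"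
      using IH[of "Suc i"] card \<open>card (insert x S) \<le> card basis\<close> by (auto simp: add.commute)
    then show ?thesis using nontrivial_remove_lower Suc.prems(1) down x(1) by blast
  next
    case False
    then obtain p where "nontrivial (insert x S) (int i) p"
      using IH[of i] card Suc.prems by auto
    then show ?thesis using nontrivial_remove_same Suc.prems(1) down x(1) by blast
  qed
qed

text \<open>The annihilator of the empty set is the whole algebra, so each wordlength from 0 to
  \<open>card basis\<close> carries a class. Counting wordlength 0 makes the inequality
  strict.\<close>

lemma dim_total_less_dim_cohomology:
  assumes fin: "finite_dim_mod cocycles coboundaries"
  shows "dim total < dim_cohomology"
proof -
  let ?n = "card basis"
  have "\<forall>i. i \<le> ?n \<longrightarrow> (\<exists>p. \<exists>z \<in> part (int i, p). d z = 0 \<and>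
      (\<forall>m \<in> part (int i - 1, p - 1). d m \<noteq> z))"
    using nontrivial_down_closed[of "{}"] by (auto simp: down_closed_def nontrivial_def annihilator_def)
  then obtain z p where zp: "\<And>i. i \<le> ?n \<Longrightarrow> z i \<in> part (int i, p i)"
    and dz: "\<And>i. i \<le> ?n \<Longrightarrow> d (z i) = 0"
    and ne: "\<And>i m. i \<le> ?n \<Longrightarrow> m \<in> part (int i - 1, p i - 1) \<Longrightarrow> d m \<noteq> z i"
    by metis
  have z0: "z i \<noteq> 0" if "i \<le> ?n" for i
    using ne[OF that subspace_0[OF subspace_part]] by simp
  have projz: "proj (int i, p i) (z j) = (if j = i then z i else 0)" if "i \<le> ?n" "j \<le> ?n" for i j
    using proj_same[OF zp[OF that(1)]] proj_other[OF zp[OF that(2)], of "(int i, p i)"] by auto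
  have inj: "inj_on z {..?n}"
    by (rule inj_onI) (metis projz z0 atMost_iff)
  have sub: "subspace coboundaries"
  proof (rule subspaceI)
    show "0 \<in> coboundaries"
      unfolding coboundaries_def by (rule range_eqI[of _ _ 0]) simp
    show "x + y \<in> coboundaries" if "x \<in> coboundaries" "y \<in> coboundaries" for x y
      using that unfolding coboundaries_def by (auto simp: d_add[symmetric])
    show "c *q x \<in> coboundaries" if "x \<in> coboundaries" for c x
      using that unfolding coboundaries_def by (auto simp: d_scale[symmetric])
  qed
  have "independent_mod coboundaries (z ` {..?n})"
    unfolding independent_mod_def
  proof (intro allI impI ballI)
    fix F u v assume F: "F \<subseteq> z ` {..?n}" "finite F" "(\<Sum>v\<in>F. u v *q v) \<in> coboundaries" "v \<in> F"
    obtain i where i: "i \<le> ?n" "v = z i" using F(1,4) by auto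
    let ?g = "(int i, p i)"
    obtain y where y: "(\<Sum>v\<in>F. u v *q v) = d y" using F(3) by (auto simp: coboundaries_def)
    have proj_sum: "proj ?g (\<Sum>w\<in>G. f w) = (\<Sum>w\<in>G. proj ?g (f w))" for G and f :: "'a \<Rightarrow> 'a"
      by (induction G rule: infinite_finite_induct) (simp_all add: proj_add)
    \<comment> \<open>Projecting to the bidegree of \<open>v\<close> isolates its coefficient. The
      projection of a coboundary is again a coboundary, of an element of the matching
      \<open>part\<close>, so a nonzero coefficient would make \<open>v\<close> exact.\<close>
    have "proj ?g w = (if w = v then v else 0)" if "w \<in> F" for w
      using that F(1) projz[OF i(1)] i inj by (auto simp: inj_on_eq_iff)
    then have "proj ?g (\<Sum>v\<in>F. u v *q v) = (\<Sum>w\<in>F. if w = v then u v *q v else 0)"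
      unfolding proj_sum proj_scale by (intro sum.cong) auto
    also have "\<dots> = u v *q v" using F(2,4) by simp
    finally have eq: "u v *q v = d (proj (?g - (1, 1)) y)" unfolding y proj_d by simp
    show "u v = 0"
    proof (rule ccontr)
      assume "u v \<noteq> 0"
      then have "v = inverse (u v) *q (u v *q v)" by simp
      also have "\<dots> = d (inverse (u v) *q proj (?g - (1, 1)) y)" unfolding eq d_scale ..
      finally have "d (inverse (u v) *q proj (?g - (1, 1)) y) = z i" using i by simp
      moreover have "inverse (u v) *q proj (?g - (1, 1)) y \<in> part (int i - 1, p i - 1)"
        using subspace_scale[OF subspace_part proj_part[of "?g - (1, 1)" y]] by simp
      ultimately show False using ne[OF i(1)] by blast
    qed
  qed
  moreover have "z ` {..?n} \<subseteq> cocycles" using dz by (auto simp: cocycles_def)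
  ultimately have "card (z ` {..?n}) \<le> dim_cohomology"
    unfolding dim_cohomology_def using sub fin by (intro card_le_dim_mod)
  then show ?thesis using inj card_basis by (simp add: card_image)
qed

end

theorem proposition4:
  fixes scale :: "rat \<Rightarrow> 'a::ring_1 \<Rightarrow> 'a"
    and V :: "nat \<Rightarrow> 'a set"
    and d :: "'a \<Rightarrow> 'a"
  assumes "minimal_sullivan_algebra scale V d"
    and "sullivan_algebra.one_connected V"
    and "sullivan_algebra.elliptic scale V d"
    and "sullivan_algebra.coformal scale V d"
    and "\<forall>n. even n \<longrightarrow> V n = {0}"
  shows "sullivan_algebra.dim_cohomology scale d
    \<ge> vector_space.dim scale (graded_subspace.total scale V)"
proof -
  interpret M: minimal_sullivan_algebra scale V d by (rule assms(1))
  interpret odd_coformal_algebra scale V d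
    by unfold_locales
      (use assms(2-5) in \<open>auto simp: M.one_connected_def M.elliptic_def M.coformal_def\<close>)
  have "M.finite_dim_mod M.cocycles M.coboundaries"
    using assms(3) by (simp add: M.elliptic_def)
  then show ?thesis by (intro less_imp_le dim_total_less_dim_cohomology)
qed

end
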